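(* Let $\Gamma$ be a thick locally finitely chained generalized $n$-gon with $n\in\{4,6\}$, and let $\gamma:\Gamma\to\Delta$ be an epimorphism, with $\Delta$ a thin $n$-gon of order $(s,1)$. Then $s=1$, and, after a suitable naming of the points of $\Delta$, $\gamma$ is of type (a) or of type (b) (the types for $n=4$, respectively $n=6$, being those defined in the context).
   Context: Polygons. A point-line geometry is a weak generalized $n$-gon ($n\ge 3$) if any two elements (points or lines) lie in a common ordinary sub $n$-gon and there are no ordinary sub $k$-gons for $2\le k<n$; it is thick (a generalized $n$-gon) if every point is on at least three lines and every line has at least three points, and thin if it is not thick. Order $(u,v)$: each line has $u+1$ points and each point is on $v+1$ lines (possibly infinite). A morphism maps points to points, lines to lines, and preserves incidence; an epimorphism is a morphism surjective on points and on lines. $x\sim y$ means collinear; $\overline{x}\overline{y}$ is the line joining distinct collinear points. The point-line dual is obtained by interchanging points and lines. Locally finitely chained. A sub $n$-gon is a (thin or thick) weak generalized $n$-gon whose points and lines are points and lines of $\Gamma$, with induced incidence. For a point set $S$ of $\Gamma$, $\langle S\rangle$ is the intersection of all (thin and thick) sub $n$-gons containing $S$. $\Gamma$ is locally finitely chained if there is a chain of finite point subsets $S_0\subseteq S_1\subseteq\cdots\subseteq S_i\subseteq\cdots$ such that each $\langle S_j\rangle$ is a finite (possibly thin) sub $n$-gon and $\bigcup_{i\ge0}\langle S_i\rangle=\Gamma$. Type (a), $n=4$. $\Delta$ has points $\overline{a}\sim\overline{b}\sim\overline{c}\sim\overline{d}\sim\overline{a}$; write $\widetilde{X}=\gamma^{-1}(\overline{x})$.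 There is a line $L$ of $\Gamma$ such that $(\widetilde{A},\widetilde{B})$ is a partition of the points incident with $L$ into two nonempty sets; $\widetilde{C}$ (resp. $\widetilde{D}$) consists of the points not on $L$ collinear with a point of $\widetilde{B}$ (resp. $\widetilde{A}$); $\gamma^{-1}(\overline{a}\overline{b})=\{L\}$; $\gamma^{-1}(\overline{b}\overline{c})$ (resp. $\gamma^{-1}(\overline{a}\overline{d})$) is the set of lines distinct from $L$ incident with a point of $\widetilde{B}$ (resp. $\widetilde{A}$); $\gamma^{-1}(\overline{c}\overline{d})$ consists of the lines incident with at least one point of $\widetilde{C}$ and at least one point of $\widetilde{D}$. Type (a), $n=6$. $\Delta$ has points $\overline{a}\sim\overline{b}\sim\overline{c}\sim\overline{d}\sim\overline{e}\sim\overline{f}\sim\overline{a}$; write $\widetilde{X}=\gamma^{-1}(\overline{x})$. There is a line $L$ of $\Gamma$ such that $(\widetilde{C},\widetilde{B})$ is a partition of the points incident with $L$ into two nonempty sets; $\widetilde{D}$ (resp. $\widetilde{A}$) consists of the points not on $L$ collinear with a point of $\widetilde{C}$ (resp. $\widetilde{B}$); $\widetilde{E}$ consists of the points not in $\widetilde{C}\cup\widetilde{D}$ collinear with a point of $\widetilde{D}$; $\widetilde{F}$ consists of the points not in $\widetilde{A}\cup\widetilde{B}$ collinear with a point of $\widetilde{A}$; $\gamma^{-1}(\overline{b}\overline{c})=\{L\}$; $\gamma^{-1}(\overline{c}\overline{d})$ (resp. $\gamma^{-1}(\overline{a}\overline{b})$) is the set of lines distinct from $L$ incident with a point of $\widetilde{C}$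 (resp. $\widetilde{B}$); $\gamma^{-1}(\overline{d}\overline{e})$ is the set of lines not in $\gamma^{-1}(\overline{c}\overline{d})$ incident with a point of $\widetilde{D}$; $\gamma^{-1}(\overline{f}\overline{a})$ is the set of lines not in $\gamma^{-1}(\overline{a}\overline{b})$ incident with a point of $\widetilde{A}$; $\gamma^{-1}(\overline{f}\overline{e})$ is the set of lines not in $\gamma^{-1}(\overline{f}\overline{a})$ incident with a point of $\widetilde{F}$ (equivalently, the lines not in $\gamma^{-1}(\overline{d}\overline{e})$ incident with a point of $\widetilde{E}$). Type (b). $\gamma$, regarded as an epimorphism from the point-line dual of $\Gamma$ onto the point-line dual of $\Delta$, is of type (a). *)

theory Defs
  imports "HOL-Library.Extended_Nat" "HOL-Library.Equipollence"
begin

record ('p, 'l) geometry =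
  pts :: "'p set"
  lns :: "'l set"
  inc :: "('p \<times> 'l) set"

definition point_line_geometry :: "('p, 'l) geometry \<Rightarrow> bool" where
  "point_line_geometry G \<longleftrightarrow> inc G \<subseteq> pts G \<times> lns G"

definition dual :: "('p, 'l) geometry \<Rightarrow> ('l, 'p) geometry" where
  "dual G = \<lparr>pts = lns G, lns = pts G, inc = (inc G)\<inverse>\<rparr>"

definition elements :: "('p, 'l) geometry \<Rightarrow> ('p + 'l) set" where
  "elements G = pts G <+> lns G"

definition points_on :: "('p, 'l) geometry \<Rightarrow> 'l \<Rightarrow> 'p set" where
  "points_on G l = {p \<in> pts G. (p, l) \<in> inc G}"

definition lines_through :: "('p, 'l) geometry \<Rightarrow> 'p \<Rightarrow> 'l set" where
  "lines_through G p = {l \<in> lns G. (p, l) \<in> inc G}"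

definition subgeometry :: "('p, 'l) geometry \<Rightarrow> ('p, 'l) geometry \<Rightarrow> bool" where
  "subgeometry H G \<longleftrightarrow>
     pts H \<subseteq> pts G \<and> lns H \<subseteq> lns G \<and> inc H = inc G \<inter> (pts H \<times> lns H)"

definition ordinary_gon :: "nat \<Rightarrow> ('p, 'l) geometry \<Rightarrow> bool" where
  "ordinary_gon k H \<longleftrightarrow> point_line_geometry H \<and>
     (\<exists>p l. bij_betw p {..<k} (pts H) \<and> bij_betw l {..<k} (lns H) \<and>
        (\<forall>i<k. \<forall>j<k. (p i, l j) \<in> inc H \<longleftrightarrow> i = j \<or> i = Suc j mod k))"

text \<open>The two elements \<open>x\<close>, \<open>y\<close> may coincide, and the empty geometry is excluded; so every
  weak generalized polygon contains an ordinary one.\<close>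

definition weak_generalized_gon :: "nat \<Rightarrow> ('p, 'l) geometry \<Rightarrow> bool" where
  "weak_generalized_gon n G \<longleftrightarrow> 3 \<le> n \<and> point_line_geometry G \<and> elements G \<noteq> {} \<and>
     (\<forall>x \<in> elements G. \<forall>y \<in> elements G.
        \<exists>H. subgeometry H G \<and> ordinary_gon n H \<and> x \<in> elements H \<and> y \<in> elements H) \<and>
     (\<forall>k. 2 \<le> k \<and> k < n \<longrightarrow> \<not> (\<exists>H. subgeometry H G \<and> ordinary_gon k H))"

definition ecard :: "'a set \<Rightarrow> enat" where
  "ecard A = (if finite A then enat (card A) else \<infinity>)"

definition thick :: "('p, 'l) geometry \<Rightarrow> bool" where
  "thick G \<longleftrightarrow> (\<forall>p \<in> pts G. 3 \<le> ecard (lines_through G p)) \<and>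
               (\<forall>l \<in> lns G. 3 \<le> ecard (points_on G l))"

definition thick_generalized_gon :: "nat \<Rightarrow> ('p, 'l) geometry \<Rightarrow> bool" where
  "thick_generalized_gon n G \<longleftrightarrow> weak_generalized_gon n G \<and> thick G"

definition thin_gon :: "nat \<Rightarrow> ('p, 'l) geometry \<Rightarrow> bool" where
  "thin_gon n G \<longleftrightarrow> weak_generalized_gon n G \<and> \<not> thick G"

text \<open>Since \<open>enat\<close> has only one infinite value, uniformity of the order is stated by
  equipollence in addition, so that it also holds for infinite cardinals.\<close>

definition has_order :: "('p, 'l) geometry \<Rightarrow> enat \<Rightarrow> enat \<Rightarrow> bool" where
  "has_order G u v \<longleftrightarrow>
     (\<forall>l \<in> lns G. ecard (points_on G l) = u + 1) \<and>
     (\<forall>p \<in> pts G. ecard (lines_through G p) = v + 1) \<and>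
     (\<forall>l \<in> lns G. \<forall>m \<in> lns G. points_on G l \<approx> points_on G m) \<and>
     (\<forall>p \<in> pts G. \<forall>q \<in> pts G. lines_through G p \<approx> lines_through G q)"

definition collinear :: "('p, 'l) geometry \<Rightarrow> 'p \<Rightarrow> 'p \<Rightarrow> bool" where
  "collinear G x y \<longleftrightarrow> (\<exists>l \<in> lns G. x \<in> points_on G l \<and> y \<in> points_on G l)"

text \<open>Meaningful only for distinct collinear \<open>x\<close>, \<open>y\<close> in a geometry without ordinary sub 2-gons.\<close>

definition join :: "('p, 'l) geometry \<Rightarrow> 'p \<Rightarrow> 'p \<Rightarrow> 'l" where
  "join G x y = (THE l. l \<in> lns G \<and> x \<in> points_on G l \<and> y \<in> points_on G l)"

definition sub_gon :: "nat \<Rightarrow> ('p, 'l) geometry \<Rightarrow> ('p, 'l) geometry \<Rightarrow> bool" where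
  "sub_gon n H G \<longleftrightarrow> subgeometry H G \<and> weak_generalized_gon n H"

definition generated :: "nat \<Rightarrow> ('p, 'l) geometry \<Rightarrow> 'p set \<Rightarrow> ('p, 'l) geometry" where
  "generated n G S =
     (let \<H> = {H. sub_gon n H G \<and> S \<subseteq> pts H}
      in \<lparr>pts = \<Inter> (pts ` \<H>), lns = \<Inter> (lns ` \<H>), inc = \<Inter> (inc ` \<H>)\<rparr>)"

definition locally_finitely_chained :: "nat \<Rightarrow> ('p, 'l) geometry \<Rightarrow> bool" where
  "locally_finitely_chained n G \<longleftrightarrow>
     (\<exists>S :: nat \<Rightarrow> 'p set.
        (\<forall>i. finite (S i) \<and> S i \<subseteq> pts G \<and> S i \<subseteq> S (Suc i)) \<and>
        (\<forall>i. sub_gon n (generated n G (S i)) G \<and>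
             finite (pts (generated n G (S i))) \<and> finite (lns (generated n G (S i)))) \<and>
        (\<Union>i. pts (generated n G (S i))) = pts G \<and>
        (\<Union>i. lns (generated n G (S i))) = lns G \<and>
        (\<Union>i. inc (generated n G (S i))) = inc G)"

text \<open>A morphism is a pair of maps, \<open>f\<close> on points and \<open>g\<close> on lines; values outside the carriers
  are irrelevant.\<close>

definition morphism ::
  "('p, 'l) geometry \<Rightarrow> ('q, 'm) geometry \<Rightarrow> ('p \<Rightarrow> 'q) \<Rightarrow> ('l \<Rightarrow> 'm) \<Rightarrow> bool" where
  "morphism G D f g \<longleftrightarrow> f ` pts G \<subseteq> pts D \<and> g ` lns G \<subseteq> lns D \<and>
     (\<forall>(p, l) \<in> inc G. (f p, g l) \<in> inc D)"

definition epimorphism ::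
  "('p, 'l) geometry \<Rightarrow> ('q, 'm) geometry \<Rightarrow> ('p \<Rightarrow> 'q) \<Rightarrow> ('l \<Rightarrow> 'm) \<Rightarrow> bool" where
  "epimorphism G D f g \<longleftrightarrow> morphism G D f g \<and> f ` pts G = pts D \<and> g ` lns G = lns D"

definition fibre :: "'x set \<Rightarrow> ('x \<Rightarrow> 'y) \<Rightarrow> 'y \<Rightarrow> 'x set" where
  "fibre X h y = {x \<in> X. h x = y}"

text \<open>In the two definitions below the upper case letters \<open>A\<close>, \<open>B\<close>, and so on are the fibres of the
  points \<open>a\<close>, \<open>b\<close>, and so on of \<open>\<Delta>\<close>, and \<open>M x y\<close> is the fibre of the line joining \<open>x\<close> and \<open>y\<close>.\<close>

definition type_a4 ::
  "('p, 'l) geometry \<Rightarrow> ('q, 'm) geometry \<Rightarrow> ('p \<Rightarrow> 'q) \<Rightarrow> ('l \<Rightarrow> 'm) \<Rightarrow> bool" where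
  "type_a4 G \<Delta> \<phi> \<psi> \<longleftrightarrow>
     (\<exists>a b c d. pts \<Delta> = {a, b, c, d} \<and> distinct [a, b, c, d] \<and>
        collinear \<Delta> a b \<and> collinear \<Delta> b c \<and> collinear \<Delta> c d \<and> collinear \<Delta> d a \<and>
        (let A = fibre (pts G) \<phi> a; B = fibre (pts G) \<phi> b;
             C = fibre (pts G) \<phi> c; D = fibre (pts G) \<phi> d;
             M = (\<lambda>x y. fibre (lns G) \<psi> (join \<Delta> x y))
         in \<exists>L \<in> lns G.
           A \<union> B = points_on G L \<and> A \<inter> B = {} \<and> A \<noteq> {} \<and> B \<noteq> {} \<and>
           C = {x \<in> pts G. x \<notin> points_on G L \<and> (\<exists>y \<in> B. collinear G x y)} \<and>
           D = {x \<in> pts G. x \<notin> points_on G L \<and> (\<exists>y \<in> A. collinear G x y)} \<and>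
           M a b = {L} \<and>
           M b c = {l \<in> lns G. l \<noteq> L \<and> (\<exists>y \<in> B. y \<in> points_on G l)} \<and>
           M a d = {l \<in> lns G. l \<noteq> L \<and> (\<exists>y \<in> A. y \<in> points_on G l)} \<and>
           M c d = {l \<in> lns G. (\<exists>x \<in> C. x \<in> points_on G l) \<and> (\<exists>y \<in> D. y \<in> points_on G l)}))"

definition type_a6 ::
  "('p, 'l) geometry \<Rightarrow> ('q, 'm) geometry \<Rightarrow> ('p \<Rightarrow> 'q) \<Rightarrow> ('l \<Rightarrow> 'm) \<Rightarrow> bool" where
  "type_a6 G \<Delta> \<phi> \<psi> \<longleftrightarrow>
     (\<exists>a b c d e f. pts \<Delta> = {a, b, c, d, e, f} \<and> distinct [a, b, c, d, e, f] \<and>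
        collinear \<Delta> a b \<and> collinear \<Delta> b c \<and> collinear \<Delta> c d \<and>
        collinear \<Delta> d e \<and> collinear \<Delta> e f \<and> collinear \<Delta> f a \<and>
        (let A = fibre (pts G) \<phi> a; B = fibre (pts G) \<phi> b; C = fibre (pts G) \<phi> c;
             D = fibre (pts G) \<phi> d; E = fibre (pts G) \<phi> e; F = fibre (pts G) \<phi> f;
             M = (\<lambda>x y. fibre (lns G) \<psi> (join \<Delta> x y))
         in \<exists>L \<in> lns G.
           C \<union> B = points_on G L \<and> C \<inter> B = {} \<and> C \<noteq> {} \<and> B \<noteq> {} \<and>
           D = {x \<in> pts G. x \<notin> points_on G L \<and> (\<exists>y \<in> C. collinear G x y)} \<and>
           A = {x \<in> pts G. x \<notin> points_on G L \<and> (\<exists>y \<in> B. collinear G x y)} \<and>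
           E = {x \<in> pts G. x \<notin> C \<union> D \<and> (\<exists>y \<in> D. collinear G x y)} \<and>
           F = {x \<in> pts G. x \<notin> A \<union> B \<and> (\<exists>y \<in> A. collinear G x y)} \<and>
           M b c = {L} \<and>
           M c d = {l \<in> lns G. l \<noteq> L \<and> (\<exists>y \<in> C. y \<in> points_on G l)} \<and>
           M a b = {l \<in> lns G. l \<noteq> L \<and> (\<exists>y \<in> B. y \<in> points_on G l)} \<and>
           M d e = {l \<in> lns G. l \<notin> M c d \<and> (\<exists>y \<in> D. y \<in> points_on G l)} \<and>
           M f a = {l \<in> lns G. l \<notin> M a b \<and> (\<exists>y \<in> A. y \<in> points_on G l)} \<and>
           M f e = {l \<in> lns G. l \<notin> M f a \<and> (\<exists>y \<in> F. y \<in> points_on G l)} \<and>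
           M f e = {l \<in> lns G. l \<notin> M d e \<and> (\<exists>y \<in> E. y \<in> points_on G l)}))"

definition type_a ::
  "nat \<Rightarrow> ('p, 'l) geometry \<Rightarrow> ('q, 'm) geometry \<Rightarrow> ('p \<Rightarrow> 'q) \<Rightarrow> ('l \<Rightarrow> 'm) \<Rightarrow> bool" where
  "type_a n G D f g \<longleftrightarrow> n = 4 \<and> type_a4 G D f g \<or> n = 6 \<and> type_a6 G D f g"

definition type_b ::
  "nat \<Rightarrow> ('p, 'l) geometry \<Rightarrow> ('q, 'm) geometry \<Rightarrow> ('p \<Rightarrow> 'q) \<Rightarrow> ('l \<Rightarrow> 'm) \<Rightarrow> bool" where
  "type_b n G D f g \<longleftrightarrow> type_a n (dual G) (dual D) g f"

end

theory Submission
  imports Defs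
begin

text \<open>Points and lines are the vertices of the incidence graph, which has diameter \<open>n\<close> and unique shortest
  paths between vertices at distance less than \<open>n\<close>. Compose \<open>\<gamma>\<close> with the retraction of \<open>\<Delta>\<close> onto an ordinary
  \<open>n\<close>-gon centred at a flag: this labels the vertices of \<open>\<Gamma>\<close> by \<open>\<int>/2n\<close> so that adjacent labels differ by
  one. Vertices whose labels differ by \<open>n\<close> are opposite, hence the number \<open>p\<^sub>i\<close> of upper neighbours (label
  \<open>i + 1\<close>) of a vertex with label \<open>i\<close> depends only on \<open>i\<close> and equals the number of lower neighbours of a
  vertex with label \<open>i + n\<close>. Matching the neighbours of two opposite vertices with labels \<open>i\<close> and \<open>i + n - 2\<close>
  gives \<open>p\<^bsub>i+n-2\<^esub> \<le> p\<^sub>i\<close>, strictly if some shortest path between such vertices has its backward step in the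
  interior. If no \<open>p\<^sub>i\<close> is \<open>1\<close>, then all these inequalities are strict, which is absurd in a
  finite sub \<open>n\<close>-gon. So some \<open>p\<^sub>i\<close> is \<open>1\<close>, and the same inequality produces \<open>n - 1\<close> consecutive indices with
  \<open>p\<^sub>i = 1\<close>. Then some label is taken by a single vertex \<open>e\<close>, and \<open>\<gamma>\<close> preserves the distance from \<open>e\<close>. If
  \<open>s \<ge> 2\<close>, moving the flag gives two such vertices far apart, and a point of \<open>\<Gamma>\<close> over a point between their
  images would lie on only two lines. If \<open>s = 1\<close>, the vertex \<open>e\<close> is the line \<open>L\<close> of type (a) or its dual.\<close>

section \<open>Polygons as metric graphs\<close>

text \<open>The axioms describe the incidence graph by its metric only, so that points and lines are
  treated alike: it is bipartite (\<open>d_step\<close>), of diameter at most \<open>n\<close>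
  (\<open>d_le\<close>), without end vertices, and \<open>d_unique\<close> excludes circuits shorter
  than \<open>2 * n\<close>.\<close>

locale polygon =
  fixes V :: "'v set" and adj :: "'v \<Rightarrow> 'v \<Rightarrow> bool" and d :: "'v \<Rightarrow> 'v \<Rightarrow> nat" and n :: nat
  assumes n_ge_3: "3 \<le> n"
    and adj_sym: "adj x y \<Longrightarrow> adj y x"
    and adj_in: "adj x y \<Longrightarrow> x \<in> V"
    and d_sym: "d x y = d y x"
    and d_eq_0: "x \<in> V \<Longrightarrow> y \<in> V \<Longrightarrow> d x y = 0 \<longleftrightarrow> x = y"
    and d_le: "x \<in> V \<Longrightarrow> y \<in> V \<Longrightarrow> d x y \<le> n"
    and d_step: "x \<in> V \<Longrightarrow> adj y z \<Longrightarrow> d x z = Suc (d x y) \<or> d x y = Suc (d x z)"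
    and d_pred: "x \<in> V \<Longrightarrow> y \<in> V \<Longrightarrow> d x y = Suc k \<Longrightarrow> \<exists>z. adj y z \<and> d x z = k"
    and d_unique: "x \<in> V \<Longrightarrow> d x y = Suc k \<Longrightarrow> Suc k < n \<Longrightarrow> adj y z \<Longrightarrow> adj y z' \<Longrightarrow>
      d x z = k \<Longrightarrow> d x z' = k \<Longrightarrow> z = z'"
    and deg_ge_2: "x \<in> V \<Longrightarrow> \<exists>y z. adj x y \<and> adj x z \<and> y \<noteq> z"
begin

lemma adj_in2: "adj x y \<Longrightarrow> y \<in> V"
  using adj_sym adj_in by blast

lemma d_self [simp]: "x \<in> V \<Longrightarrow> d x x = 0"
  using d_eq_0 by simp

lemma d_eq_1: "x \<in> V \<Longrightarrow> y \<in> V \<Longrightarrow> d x y = Suc 0 \<longleftrightarrow> adj x y"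
  by (metis adj_in2 adj_sym d_eq_0 d_pred d_self d_step nat.distinct(1))

text \<open>Only one neighbour of \<open>y\<close> is nearer to \<open>x\<close>, so every other one
  is farther. Hence paths without backtracking are shortest up to length \<open>n\<close>.\<close>

lemma d_away:
  assumes "x \<in> V" "d x y = Suc k" "Suc k < n" "adj y z" "d x z = k" "adj y w" "w \<noteq> z"
  shows "d x w = Suc (Suc k)"
  using assms d_step[of x y w] d_unique[of x y k z w] by auto

lemma d_step2: "x \<in> V \<Longrightarrow> adj y z \<Longrightarrow> d z x = Suc (d y x) \<or> d y x = Suc (d z x)"
  using d_step[of x y z] d_sym[of x y] d_sym[of x z] by simp

text \<open>\<open>x'\<close> is one step closer to \<open>y\<close>, hence at distance
  \<open>n - 1\<close>, where the next step towards \<open>x'\<close> is unique. Used from both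
  ends, this matches the neighbours of two opposite vertices.\<close>

lemma partner:
  assumes "x \<in> V" "y \<in> V" "d x y = n" "adj x x'"
  shows "\<exists>!y'. adj y y' \<and> d x' y' = n - 2"
proof -
  have x': "x' \<in> V" using assms adj_in2 by blast
  have "d y x' = Suc (n - 2)"
    using d_step[of y x x'] d_le[of y x'] assms x' n_ge_3 d_sym[of x y] by auto
  hence 1: "d x' y = Suc (n - 2)" using d_sym by simp
  obtain y' where "adj y y'" "d x' y' = n - 2" using d_pred[OF x' assms(2) 1] by blast
  thus ?thesis using d_unique[OF x' 1] n_ge_3 by auto
qed

section \<open>Branches on either side of an edge, and the labels they define\<close>

definition branch :: "'v \<Rightarrow> 'v \<Rightarrow> nat \<Rightarrow> 'v set" where
  "branch a b k = {x \<in> V. d a x = k \<and> d b x = Suc k}"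

lemma branch_0: "adj a b \<Longrightarrow> branch a b 0 = {a}"
  unfolding branch_def using adj_in adj_in2 d_eq_0 d_eq_1 adj_sym by auto

text \<open>The last two hypotheses exclude backtracking: no step back towards \<open>a\<close>, and
  for \<open>k = 0\<close> not the step to \<open>b\<close>, which enters the other branch. The step
  then leads away from both \<open>a\<close> and \<open>b\<close>.\<close>

lemma branch_Suc:
  assumes "adj a b" "x \<in> branch a b k" "Suc k < n" "adj x y" "k = 0 \<Longrightarrow> y \<noteq> b"
    and "\<And>z. adj x z \<Longrightarrow> Suc (d a z) = k \<Longrightarrow> y \<noteq> z"
  shows "y \<in> branch a b (Suc k)"
proof -
  have V: "a \<in> V" "b \<in> V" "x \<in> V" "y \<in> V" using assms adj_in adj_in2 by blast+
  have dx: "d a x = k" "d b x = Suc k" using assms(2) by (auto simp: branch_def)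
  have "d a y = Suc k \<and> d b y = Suc (Suc k)"
  proof (cases k)
    case 0
    hence "x = a" using dx d_eq_0 V by auto
    hence "d a y = Suc 0" "d b y \<noteq> 0" using assms d_eq_1 d_eq_0 V 0 by auto
    thus ?thesis using d_step[OF V(2) assms(4)] 0 dx by auto
  next
    case (Suc j)
    then obtain z where z: "adj x z" "d a z = j" using d_pred V dx by blast
    have yz: "y \<noteq> z" using assms(6)[of z] z Suc by auto
    have "d b z = k"
      using d_step[OF V(2) z(1)] d_step2[OF adj_in2[OF z(1)] assms(1)] z(2) dx Suc by presburger
    thus ?thesis using d_away[of a x j z y] d_away[of b x k z y] V z dx Suc assms(3,4) yz by simp
  qed
  thus ?thesis using V by (auto simp: branch_def)
qed

lemma branch_extend:
  assumes "adj a b" "x \<in> branch a b k" "Suc k < n"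
  shows "\<exists>y. adj x y \<and> y \<in> branch a b (Suc k)"
proof -
  have V: "a \<in> V" "b \<in> V" "x \<in> V" using assms adj_in adj_in2 by (auto simp: branch_def)
  have dx: "d a x = k" using assms(2) by (auto simp: branch_def)
  have "\<exists>w. \<forall>y. adj x y \<longrightarrow> y \<noteq> w \<longrightarrow> y \<in> branch a b (Suc k)"
  proof (cases k)
    case 0
    thus ?thesis using branch_Suc[OF assms] by (metis nat.distinct(1))
  next
    case (Suc j)
    then obtain z where z: "adj x z" "d a z = j" using d_pred V dx by blast
    have "z' = z" if "adj x z'" "Suc (d a z') = k" for z'
      using d_unique[of a x j z z'] z that V dx Suc assms by auto
    thus ?thesis using branch_Suc[OF assms] Suc by blast
  qed
  thus ?thesis using deg_ge_2[OF V(3)] by metis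
qed

lemma branch_ne:
  assumes "adj a b" "k < n"
  shows "branch a b k \<noteq> {}"
  using assms(2)
proof (induction k)
  case 0
  thus ?case using branch_0 assms by simp
next
  case (Suc k)
  thus ?case using branch_extend[OF assms(1)] by (metis Suc_lessD equals0I empty_iff)
qed

text \<open>Three neighbours at \<open>a\<close> suffice for two vertices on every later level:
  different vertices of one level have different extensions, because the step back towards
  \<open>a\<close> is unique.\<close>

lemma branch_two:
  assumes ab: "adj a b" and deg3: "\<forall>w. \<exists>y. adj a y \<and> y \<noteq> b \<and> y \<noteq> w"
    and "x \<in> branch a b (Suc k)" "Suc k < n"
  shows "\<exists>y \<in> branch a b (Suc k). y \<noteq> x"
  using assms(3,4)
proof (induction k arbitrary: x)
  case 0
  obtain y where y: "adj a y" "y \<noteq> b" "y \<noteq> x" using deg3 by blast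
  have "y \<in> branch a b (Suc 0)"
    using branch_Suc[OF ab, of a 0 y] branch_0[OF ab] y 0 by auto
  thus ?case using y by blast
next
  case (Suc k)
  have V: "a \<in> V" "x \<in> V" using Suc ab adj_in by (auto simp: branch_def)
  have bV: "b \<in> V" using ab adj_in2 by blast
  obtain x' where x': "adj x x'" "d a x' = Suc k"
    using d_pred[OF V] Suc by (auto simp: branch_def)
  have "d b x = Suc (Suc (Suc k))" using Suc(2) by (simp add: branch_def)
  hence "d b x' = Suc (Suc k)"
    using d_step[OF bV x'(1)] d_step2[OF adj_in2[OF x'(1)] ab] x'(2) by presburger
  hence "x' \<in> branch a b (Suc k)" using x' adj_in2 by (auto simp: branch_def)
  then obtain y' where y': "y' \<in> branch a b (Suc k)" "y' \<noteq> x'" using Suc by auto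
  obtain y where y: "adj y' y" "y \<in> branch a b (Suc (Suc k))"
    using branch_extend[OF ab y'(1)] Suc by auto
  have "y \<noteq> x"
    using d_unique[OF V(1), of y "Suc k" x' y'] y y' x' Suc adj_sym by (auto simp: branch_def)
  thus ?case using y by blast
qed

text \<open>The integers from \<open>1 - n\<close> to \<open>n\<close> stand for the vertices of an
  ordinary polygon, \<open>a\<close> being \<open>0\<close> and \<open>b\<close> being
  \<open>1\<close>; a vertex goes to the one on the same side of the edge at the same distance.
  Values are read modulo \<open>2 * n\<close>, so that the two ends are neighbours.\<close>

definition retraction :: "'v \<Rightarrow> 'v \<Rightarrow> 'v \<Rightarrow> int" where
  "retraction a b x = (if d b x < d a x then 1 + int (d b x) else - int (d a x))"

lemma retraction_branch1: "x \<in> branch b a k \<Longrightarrow> retraction a b x = 1 + int k"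
  by (auto simp: branch_def retraction_def)

lemma retraction_branch0: "x \<in> branch a b k \<Longrightarrow> retraction a b x = - int k"
  by (auto simp: branch_def retraction_def)

lemma branch_cases:
  assumes "adj a b" "x \<in> V"
  obtains k where "k < n" "x \<in> branch a b k" | k where "k < n" "x \<in> branch b a k"
proof -
  have ab: "a \<in> V" "b \<in> V" using assms adj_in adj_in2 by blast+
  have "d a x = Suc (d b x) \<or> d b x = Suc (d a x)"
    using d_step2[OF assms(2,1)] by auto
  thus ?thesis
  proof
    assume "d a x = Suc (d b x)"
    thus ?thesis using that(2)[of "d b x"] d_le[of a x] ab assms(2) by (simp add: branch_def)
  next
    assume "d b x = Suc (d a x)"
    thus ?thesis using that(1)[of "d a x"] d_le[of b x] ab assms(2) by (simp add: branch_def)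
  qed
qed

text \<open>Besides the edge from \<open>a\<close> to \<open>b\<close>, the branches are joined only
  at their ends. Otherwise \<open>y\<close> and the step \<open>z\<close> from \<open>x\<close> back
  to \<open>a\<close> would be two different neighbours of \<open>x\<close> nearer to
  \<open>b\<close>.\<close>

lemma branch_cross:
  assumes ab: "adj a b" and "x \<in> branch a b k" "y \<in> branch b a l" "adj x y"
  shows "k = l \<and> (k = 0 \<or> k = n - 1)"
proof -
  have V: "a \<in> V" "b \<in> V" "x \<in> V" "y \<in> V" using assms adj_in adj_in2 by blast+
  have ds: "d a x = k" "d b x = Suc k" "d b y = l" "d a y = Suc l"
    using assms by (auto simp: branch_def)
  have kl: "k = l" using d_step[OF V(1) assms(4)] d_step[OF V(2) assms(4)] ds by presburger
  have False if k: "0 < k" "Suc k < n"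
  proof -
    obtain j where j: "k = Suc j" using k by (cases k) auto
    obtain z where z: "adj x z" "d a z = j" using d_pred V ds j by blast
    have dz: "d b z = k"
      using d_step[OF V(2) z(1)] d_step2[OF adj_in2[OF z(1)] ab] z(2) ds j by presburger
    have "z = y" using d_unique[OF V(2) ds(2) k(2) z(1) assms(4)] dz ds kl by auto
    thus False using z ds kl j by auto
  qed
  moreover have "Suc k \<le> n" using d_le[of b x] V ds by auto
  ultimately show ?thesis using kl by fastforce
qed

lemma retraction_step:
  assumes ab: "adj a b" and xy: "adj x y"
  shows "2 * int n dvd retraction a b y - retraction a b x - 1
       \<or> 2 * int n dvd retraction a b y - retraction a b x + 1"
proof -
  have V: "a \<in> V" "b \<in> V" "x \<in> V" "y \<in> V" using assms adj_in adj_in2 by blast+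
  show ?thesis
  proof (cases rule: branch_cases[OF ab V(3)])
    case (1 k)
    show ?thesis
    proof (cases rule: branch_cases[OF ab V(4)])
      case (1 l)
      thus ?thesis
        using \<open>x \<in> branch a b k\<close> d_step[OF V(1) xy] by (auto simp: retraction_branch0 branch_def)
    next
      case (2 l)
      thus ?thesis using branch_cross[OF ab 1(2) 2(2) xy] 1 n_ge_3
        by (auto simp: retraction_branch0[OF 1(2)] retraction_branch1[OF 2(2)] of_nat_diff)
    qed
  next
    case (2 k)
    show ?thesis
    proof (cases rule: branch_cases[OF ab V(4)])
      case (1 l)
      thus ?thesis using branch_cross[OF ab 1(2) 2(2) adj_sym[OF xy]] 2 n_ge_3
        by (auto simp: retraction_branch0[OF 1(2)] retraction_branch1[OF 2(2)] of_nat_diff)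
    next
      case (2 l)
      thus ?thesis
        using \<open>x \<in> branch b a k\<close> d_step[OF V(2) xy] by (auto simp: retraction_branch1 branch_def)
    qed
  qed
qed

lemma retraction_surj:
  assumes ab: "adj a b"
  shows "\<exists>x \<in> V. 2 * int n dvd retraction a b x - i"
proof -
  define r where "r = i mod (2 * int n)"
  have r: "0 \<le> r" "r < 2 * int n" "2 * int n dvd r - i"
    using n_ge_3 by (auto simp: r_def mod_eq_dvd_iff[symmetric])
  consider "1 \<le> r" "r \<le> int n" | "r = 0" | "int n < r" using r by linarith
  thus ?thesis
  proof cases
    case 1
    hence "nat (r - 1) < n" by linarith
    then obtain x where x: "x \<in> branch b a (nat (r - 1))" using branch_ne[OF adj_sym[OF ab]] by blast
    hence "retraction a b x = r" using retraction_branch1[OF x] 1 by auto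
    thus ?thesis using x r by (auto simp: branch_def)
  next
    case 2
    have "a \<in> branch a b 0" using branch_0[OF ab] by auto
    hence "retraction a b a = r" using retraction_branch0 2 by fastforce
    thus ?thesis using r ab adj_in by auto
  next
    case 3
    hence "nat (2 * int n - r) < n" using n_ge_3 by linarith
    then obtain x where x: "x \<in> branch a b (nat (2 * int n - r))" using branch_ne[OF ab] by blast
    hence "retraction a b x = r - 2 * int n" using retraction_branch0[OF x] r by auto
    hence "retraction a b x - i = (r - i) - 2 * int n" by simp
    hence "2 * int n dvd retraction a b x - i" using r(3) by (simp only: dvd_diff dvd_refl)
    thus ?thesis using x by (auto simp: branch_def)
  qed
qed

text \<open>All \<open>2 * n\<close> residues occur as labels, so with at most \<open>2 * n\<close>
  vertices the pigeonhole principle makes the labels distinct.\<close>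

lemma retraction_inj:
  assumes ab: "adj a b" and fin: "finite V" and card: "card V \<le> 2 * n"
  shows "card V = 2 * n"
    and "v \<in> V \<Longrightarrow> w \<in> V \<Longrightarrow> 2 * int n dvd retraction a b v - retraction a b w \<Longrightarrow> v = w"
proof -
  let ?r = "\<lambda>v. retraction a b v mod (2 * int n)"
  have "{0..<2 * int n} \<subseteq> ?r ` V"
  proof
    fix i assume i: "i \<in> {0..<2 * int n}"
    obtain v where v: "v \<in> V" "2 * int n dvd retraction a b v - i" using retraction_surj[OF ab] by blast
    hence "?r v = i" using i by (simp add: mod_eq_dvd_iff[symmetric])
    thus "i \<in> ?r ` V" using v(1) by blast
  qed
  hence "card {0..<2 * int n} \<le> card (?r ` V)" using fin by (intro card_mono) auto
  hence le: "2 * n \<le> card (?r ` V)" "card (?r ` V) \<le> card V" using card_image_le[OF fin] by auto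
  thus "card V = 2 * n" using card by simp
  have "inj_on ?r V" using le card by (intro eq_card_imp_inj_on fin) simp
  thus "v \<in> V \<Longrightarrow> w \<in> V \<Longrightarrow> 2 * int n dvd retraction a b v - retraction a b w \<Longrightarrow> v = w"
    by (auto simp: inj_on_def mod_eq_dvd_iff)
qed

end

section \<open>Labellings of the vertices by a cycle\<close>

text \<open>Degrees may be infinite, and \<open>card\<close> is 0 on infinite sets, so cardinalities
  are avoided here.\<close>

definition several :: "'a set \<Rightarrow> bool" where
  "several S \<longleftrightarrow> (\<exists>x \<in> S. \<exists>y \<in> S. x \<noteq> y)"

lemma several_inj: "inj_on f S \<Longrightarrow> f ` S \<subseteq> T \<Longrightarrow> several S \<Longrightarrow> several T"
  unfolding several_def inj_on_def by blast

lemma several_bij: "bij_betw f S T \<Longrightarrow> several S \<longleftrightarrow> several T"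
  using several_inj[of f S T] several_inj[of "inv_into S f" T S]
  by (metis bij_betw_def bij_betw_inv_into order_refl)

locale labelled_polygon = polygon V adj d n
  for V :: "'v set" and adj d n +
  fixes lab :: "'v \<Rightarrow> int"
  assumes lab_step: "adj x y \<Longrightarrow> 2 * int n dvd lab y - lab x - 1 \<or> 2 * int n dvd lab y - lab x + 1"
    and lab_surj: "\<exists>x \<in> V. 2 * int n dvd lab x - i"
begin

text \<open>Indices are arbitrary integers read modulo \<open>2 * n\<close>, so that intervals of
  labels may run past the end of the cycle.\<close>

definition L :: "int \<Rightarrow> 'v \<Rightarrow> bool" where
  "L i x \<longleftrightarrow> x \<in> V \<and> 2 * int n dvd lab x - i"

definition up :: "int \<Rightarrow> 'v \<Rightarrow> 'v set" where
  "up i x = {y. adj x y \<and> L (i + 1) y}"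

definition dn :: "int \<Rightarrow> 'v \<Rightarrow> 'v set" where
  "dn i x = {y. adj x y \<and> L (i - 1) y}"

lemma L_V: "L i x \<Longrightarrow> x \<in> V"
  by (simp add: L_def)

lemma L_ex: "\<exists>x. L i x"
  using lab_surj by (auto simp: L_def)

lemma L_lab: "x \<in> V \<Longrightarrow> L (lab x) x"
  by (simp add: L_def)

lemma L_mod: "L i x \<Longrightarrow> L j x \<longleftrightarrow> 2 * int n dvd i - j"
  using dvd_add_right_iff[of "2 * int n" "lab x - i" "i - j"] unfolding L_def by auto

lemma L_cong: "2 * int n dvd i - j \<Longrightarrow> L i x \<longleftrightarrow> L j x"
  using dvd_add_left_iff[of "2 * int n" "i - j" "lab x - i"] unfolding L_def by auto

lemma up_cong: "2 * int n dvd i - j \<Longrightarrow> up i x = up j x"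
  unfolding up_def using L_cong[of "i + 1" "j + 1"] by simp

section \<open>Displacement of labels along paths\<close>

lemma L_adj:
  assumes "L i x" "adj x y"
  shows "L (i + 1) y \<or> L (i - 1) y"
proof -
  have y: "y \<in> V" using assms adj_in2 by blast
  have "lab y - (i + 1) = (lab y - lab x - 1) + (lab x - i)"
    "lab y - (i - 1) = (lab y - lab x + 1) + (lab x - i)" by simp_all
  thus ?thesis using lab_step[OF assms(2)] assms(1) y unfolding L_def by (metis dvd_add)
qed

lemma nbr_cases: "L i x \<Longrightarrow> adj x y \<Longrightarrow> y \<in> up i x \<or> y \<in> dn i x"
  using L_adj unfolding up_def dn_def by blast

text \<open>\<open>h\<close> counts upward minus downward steps on a shortest path from
  \<open>x\<close> to \<open>y\<close>.\<close>

lemma L_disp: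
  assumes "L i x" "y \<in> V"
  shows "\<exists>h. \<bar>h\<bar> \<le> int (d x y) \<and> even (h - int (d x y)) \<and> L (i + h) y"
  using assms(2)
proof (induction "d x y" arbitrary: y)
  case 0
  hence "x = y" using d_eq_0 L_V assms by auto
  thus ?case using 0 assms by (intro exI[of _ 0]) auto
next
  case (Suc k)
  obtain z where z: "adj y z" "d x z = k" using d_pred L_V[OF assms(1)] Suc by metis
  obtain h where h: "\<bar>h\<bar> \<le> int k" "even (h - int k)" "L (i + h) z"
    using Suc(1)[of z] z adj_in2 by blast
  have "L (i + h + 1) y \<or> L (i + h - 1) y" using L_adj[OF h(3) adj_sym[OF z(1)]] .
  hence "L (i + (h + 1)) y \<or> L (i + (h - 1)) y" by (simp add: algebra_simps)
  moreover have "\<bar>h + 1\<bar> \<le> int (Suc k)" "\<bar>h - 1\<bar> \<le> int (Suc k)" "even (h + 1 - int (Suc k))"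
    "even (h - 1 - int (Suc k))" using h by auto
  ultimately show ?case unfolding Suc(2)[symmetric] by blast
qed

lemma dvd_small: "2 * int n dvd k \<Longrightarrow> \<bar>k\<bar> < 2 * int n \<Longrightarrow> k = 0"
  using dvd_imp_le_int[of k "2 * int n"] by (cases "k = 0") auto

text \<open>No integer congruent to \<open>k\<close> modulo \<open>2 * n\<close> is smaller in
  absolute value, so a path needs at least that many steps. The modulus is even, so the parity is
  determined too.\<close>

lemma L_dist:
  assumes "L i x" "L (i + k) y" "\<bar>k\<bar> \<le> int n"
  shows "\<bar>k\<bar> \<le> int (d x y)" and "even (k - int (d x y))"
proof -
  obtain h where h: "\<bar>h\<bar> \<le> int (d x y)" "even (h - int (d x y))" "L (i + h) y"
    using L_disp[OF assms(1) L_V[OF assms(2)]] by blast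
  have *: "2 * int n dvd h - k" using L_mod[OF h(3), of "i + k"] assms by simp
  hence "even (h - k)" using dvd_mult_left by blast
  thus "even (k - int (d x y))" using h(2) by presburger
  show "\<bar>k\<bar> \<le> int (d x y)"
  proof (rule ccontr)
    assume "\<not> ?thesis"
    hence "h - k = 0" using h assms by (intro dvd_small[OF *]) linarith
    thus False using h(1) \<open>\<not> \<bar>k\<bar> \<le> int (d x y)\<close> by simp
  qed
qed

section \<open>Opposite labels and the matching of neighbours\<close>

lemma L_far: "L i x \<Longrightarrow> L j y \<Longrightarrow> j - i = k \<Longrightarrow> \<bar>k\<bar> \<le> int n \<Longrightarrow> \<bar>k\<bar> \<le> int (d x y)"
  using L_dist(1)[of i x k y] by force

lemma L_opposite:
  assumes "L i x" "L (i + int n) y"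
  shows "d x y = n"
  using L_far[OF assms, of "int n"] d_le[of x y] assms L_V by auto

text \<open>The labels force distance at least \<open>n - 1\<close>, and parity excludes
  \<open>n\<close>.\<close>

lemma L_near_opposite:
  assumes "L i x" "L (i + int n - 1) y"
  shows "d x y = n - 1"
proof -
  have "L (i + (int n - 1)) y" using assms by (simp add: algebra_simps)
  from L_dist[OF assms(1) this] d_le[of x y] n_ge_3 L_V assms show ?thesis
    by (cases "d x y = n") auto
qed

text \<open>The step from \<open>x\<close> towards a vertex labelled \<open>i + n - 1\<close> goes
  up: from label \<open>i - 1\<close> that vertex would be at distance \<open>n\<close> instead of
  \<open>n - 2\<close>.\<close>

lemma up_ne: assumes "L i x" shows "up i x \<noteq> {}"
proof -
  obtain y where y: "L (i + int n - 1) y" using L_ex by blast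
  have "d y x = Suc (n - 2)" using L_near_opposite[OF assms y] n_ge_3 d_sym[of x y] by simp
  then obtain z where z: "adj x z" "d y z = n - 2" using d_pred L_V y assms by metis
  have "z \<notin> dn i x"
    using L_far[of "i - 1" z "i + int n - 1" y "int n"] y z d_sym[of y z] n_ge_3
    by (auto simp: dn_def)
  thus ?thesis using nbr_cases[OF assms z(1)] by blast
qed

text \<open>The map is the projection given by \<open>partner\<close>, and its inverse is the
  projection back. Upper neighbours go to lower ones, since labels \<open>i + 1\<close> and
  \<open>i + n + 1\<close> would force distance \<open>n\<close> where it is
  \<open>n - 2\<close>.\<close>

lemma opposite_bij:
  assumes x: "L i x" and y: "L (i + int n) y"
  shows "\<exists>\<phi>. bij_betw \<phi> (up i x) (dn (i + int n) y)"
proof -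
  have V: "x \<in> V" "y \<in> V" using assms L_V by blast+
  have dxy: "d x y = n" "d y x = n" using L_opposite[OF assms] d_sym by auto
  define \<phi> where "\<phi> x' = (THE y'. adj y y' \<and> d x' y' = n - 2)" for x'
  define \<psi> where "\<psi> y' = (THE x'. adj x x' \<and> d y' x' = n - 2)" for y'
  have \<phi>: "adj y (\<phi> x') \<and> d x' (\<phi> x') = n - 2" if "adj x x'" for x'
    unfolding \<phi>_def by (rule theI') (rule partner[OF V dxy(1) that])
  have \<psi>: "adj x (\<psi> y') \<and> d y' (\<psi> y') = n - 2" if "adj y y'" for y'
    unfolding \<psi>_def by (rule theI') (rule partner[OF V(2,1) dxy(2) that])
  have 1: "y' \<in> dn (i + int n) y" if "x' \<in> up i x" "adj y y'" "d x' y' = n - 2" for x' y'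
    using L_far[of "i + 1" x' "i + int n + 1" y' "int n"] nbr_cases[OF y that(2)] that n_ge_3
    by (auto simp: up_def)
  have 2: "x' \<in> up i x" if "y' \<in> dn (i + int n) y" "adj x x'" "d x' y' = n - 2" for x' y'
    using L_far[of "i - 1" x' "i + int n - 1" y' "int n"] nbr_cases[OF x that(2)] that n_ge_3
    by (auto simp: dn_def)
  have "bij_betw \<phi> (up i x) (dn (i + int n) y)"
  proof (rule bij_betw_byWitness[where f' = \<psi>])
    show "\<forall>x'\<in>up i x. \<psi> (\<phi> x') = x'"
      using \<phi> \<psi> partner[OF V(2,1) dxy(2)] d_sym unfolding up_def by (smt (verit) mem_Collect_eq)
    show "\<forall>y'\<in>dn (i + int n) y. \<phi> (\<psi> y') = y'"
      using \<phi> \<psi> partner[OF V dxy(1)] d_sym unfolding dn_def by (smt (verit) mem_Collect_eq)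
    show "\<phi> ` up i x \<subseteq> dn (i + int n) y" using 1 \<phi> by (auto simp: up_def)
    show "\<psi> ` dn (i + int n) y \<subseteq> up i x" using 2 \<psi> d_sym by (force simp: dn_def)
  qed
  thus ?thesis by blast
qed

lemma L_shift: "L (i - 2 * int n) x \<longleftrightarrow> L i x"
  by (rule L_cong) simp

lemma dn_ne: assumes "L i y" shows "dn i y \<noteq> {}"
proof -
  obtain x where x: "L (i - int n) x" using L_ex by blast
  obtain \<phi> where "bij_betw \<phi> (up (i - int n) x) (dn i y)"
    using opposite_bij[OF x, of y] assms by auto
  thus ?thesis using up_ne[OF x] by (metis bij_betw_empty1 bij_betw_empty2)
qed

lemma several_opposite:
  "L i x \<Longrightarrow> L (i + int n) y \<Longrightarrow> several (up i x) \<longleftrightarrow> several (dn (i + int n) y)"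
  using opposite_bij several_bij by blast

lemma card_opposite:
  "L i x \<Longrightarrow> L (i + int n) y \<Longrightarrow> card (up i x) = card (dn (i + int n) y)"
  using opposite_bij bij_betw_same_card by blast

text \<open>Both vertices are compared with a common one labelled \<open>i + n\<close>.\<close>

lemma several_up: "L i x \<Longrightarrow> L i x' \<Longrightarrow> several (up i x) \<longleftrightarrow> several (up i x')"
  using several_opposite L_ex by metis

lemma card_up: "L i x \<Longrightarrow> L i x' \<Longrightarrow> card (up i x) = card (up i x')"
  using card_opposite L_ex by metis

text \<open>The labels differ by \<open>n - 2\<close> only, so being opposite is an assumption.
  Again the projection respects upper neighbours, as an image labelled \<open>i - 1\<close> would be
  at distance \<open>n\<close>. The last clause detects a failure of surjectivity: an
  \<open>x'\<close> whose partner is a lower neighbour of \<open>y\<close> is missed, which makes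
  the inequality between the degrees strict.\<close>

lemma opposite_inj:
  assumes x: "L i x" and y: "L (i + int n - 2) y" and dxy: "d x y = n"
  obtains \<phi> where "inj_on \<phi> (up (i + int n - 2) y)" "\<phi> ` up (i + int n - 2) y \<subseteq> up i x"
    "\<And>x' y'. y' \<in> dn (i + int n - 2) y \<Longrightarrow> d x' y' = n - 2 \<Longrightarrow> x' \<notin> \<phi> ` up (i + int n - 2) y"
proof -
  let ?j = "i + int n - 2"
  have V: "x \<in> V" "y \<in> V" using assms L_V by blast+
  have dyx: "d y x = n" using dxy d_sym by simp
  define \<phi> where "\<phi> y' = (THE x'. adj x x' \<and> d y' x' = n - 2)" for y'
  have \<phi>: "adj x (\<phi> y') \<and> d y' (\<phi> y') = n - 2" if "adj y y'" for y'
    unfolding \<phi>_def by (rule theI') (rule partner[OF V(2,1) dyx that])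
  have inv: "y' = y''" if "adj y y'" "adj y y''" "d (\<phi> y') y'' = n - 2" for y' y''
    using partner[OF V dxy, of "\<phi> y'"] \<phi> that d_sym by metis
  have "inj_on \<phi> (up ?j y)"
  proof (rule inj_onI)
    fix a b assume "a \<in> up ?j y" "b \<in> up ?j y" "\<phi> a = \<phi> b"
    thus "a = b" using inv[of a b] \<phi>[of b] d_sym[of b] by (auto simp: up_def)
  qed
  moreover have "\<phi> ` up ?j y \<subseteq> up i x"
  proof (rule image_subsetI)
    fix y' assume y': "y' \<in> up ?j y"
    hence "adj x (\<phi> y')" "d (\<phi> y') y' = n - 2" using \<phi>[of y'] d_sym by (auto simp: up_def)
    thus "\<phi> y' \<in> up i x"
      using L_far[of "i - 1" "\<phi> y'" "?j + 1" y' "int n"] nbr_cases[OF x, of "\<phi> y'"] y' n_ge_3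
      by (auto simp: up_def dn_def)
  qed
  moreover have "x' \<notin> \<phi> ` up ?j y" if "y' \<in> dn ?j y" "d x' y' = n - 2" for x' y'
  proof
    assume "x' \<in> \<phi> ` up ?j y"
    then obtain y'' where y'': "y'' \<in> up ?j y" "x' = \<phi> y''" by blast
    hence "y'' = y'" using inv[of y'' y'] that by (auto simp: up_def dn_def)
    hence "L (?j + 1) y'" "L (?j - 1) y'" using y'' that by (auto simp: up_def dn_def)
    hence "2 * int n dvd 2" using L_mod[of "?j + 1" y' "?j - 1"] by simp
    thus False using dvd_small[of 2] n_ge_3 by simp
  qed
  ultimately show thesis by (rule that)
qed

text \<open>Otherwise two upper neighbours of \<open>u\<close> would start different shortest paths from \<open>u\<close> to a vertex at
  distance \<open>n - 1\<close>.\<close>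

lemma opposite_exists:
  assumes u: "L (i - 1) u" and "several (up (i - 1) u)"
  shows "\<exists>x y. L i x \<and> L (i + int n - 2) y \<and> d x y = n"
proof (rule ccontr)
  assume neg: "\<not> ?thesis"
  obtain x1 x2 where x12: "adj u x1" "adj u x2" "L i x1" "L i x2" "x1 \<noteq> x2"
    using assms by (auto simp: several_def up_def)
  obtain y where y: "L (i + int n - 2) y" using L_ex by blast
  \<comment> \<open>The labels give distance at least \<open>n - 2\<close> of the same parity, and
    \<open>n\<close> is excluded by assumption.\<close>
  have *: "d y x = n - 2" if x: "L i x" for x
  proof -
    have "L (i + (int n - 2)) y" using y by (simp add: algebra_simps)
    from L_dist[OF x this] have "int n - 2 \<le> int (d x y)" "even (int n - 2 - int (d x y))"
      using n_ge_3 by auto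
    moreover have "d x y \<le> n" "d x y \<noteq> n" using neg x y d_le L_V by blast+
    ultimately have "d x y = n - 2" using n_ge_3 by (cases "d x y = n - 1") auto
    thus ?thesis using d_sym[of x y] by simp
  qed
  have "d u y = n - 1" using L_near_opposite[OF u, of y] y by simp
  hence "d y u = Suc (n - 2)" using d_sym[of u y] n_ge_3 by simp
  moreover have "Suc (n - 2) < n" using n_ge_3 by linarith
  ultimately show False
    using d_unique[of y u "n - 2" x1 x2] x12 *[of x1] *[of x2] L_V[OF y] by blast
qed

text \<open>The path \<open>u\<close>, \<open>v\<close>, \<open>u2\<close>, \<open>v2\<close> (up,
  down, up) is continued by \<open>t\<close> upward steps to \<open>y\<close>, with
  \<open>y'\<close> just before \<open>y\<close>. It never backtracks, so it stays shortest while
  its length is at most \<open>n\<close>. Distances from \<open>v\<close> are recorded too, since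
  \<open>zigzag_down\<close> starts from the edge between \<open>u\<close> and
  \<open>v\<close>.\<close>

lemma zigzag_up:
  assumes u: "L m u" "L (m + 1) v" "L m u2" "L (m + 1) v2" and
    a: "adj u v" "adj v u2" "adj u2 v2" "u2 \<noteq> u" "v2 \<noteq> v"
    and "3 + t \<le> n"
  shows "\<exists>y y'. L (m + 1 + int t) y \<and> L (m + int t) y' \<and> adj y y' \<and>
    d u y = 3 + t \<and> d v y = 2 + t \<and> d u y' = 2 + t \<and> d v y' = 1 + t"
  using assms(10)
proof (induction t)
  case 0
  have V: "u \<in> V" "v \<in> V" "u2 \<in> V" "v2 \<in> V" using u L_V by blast+
  have "d u v = 1" "d v u2 = 1" using a V d_eq_1 by auto
  moreover have "d v v2 = 2"
    using d_away[OF V(2), of u2 0 v v2] V a adj_sym n_ge_3 calculation by auto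
  moreover have "d u u2 = 2"
    using d_away[OF V(1), of v 0 u u2] V a adj_sym n_ge_3 calculation by auto
  moreover have "d u v2 = 3"
    using d_away[OF V(1), of u2 1 v v2] V a adj_sym n_ge_3 calculation by auto
  ultimately show ?case using u a adj_sym by (intro exI[of _ v2] exI[of _ u2]) auto
next
  case (Suc t)
  then obtain y y' where y: "L (m + 1 + int t) y" "L (m + int t) y'" "adj y y'"
    "d u y = 3 + t" "d v y = 2 + t" "d u y' = 2 + t" "d v y' = 1 + t" by auto
  obtain w where w: "adj y w" "L (m + 1 + int t + 1) w" using up_ne[OF y(1)] by (auto simp: up_def)
  \<comment> \<open>Backtracking would give one vertex two labels differing by 2, which is not a
    multiple of \<open>2 * n\<close>.\<close>
  have "w \<noteq> y'"
  proof
    assume "w = y'"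
    hence "2 * int n dvd 2" using L_mod[OF w(2), of "m + int t"] y by simp
    thus False using dvd_small[of 2] n_ge_3 by simp
  qed
  hence "d u w = 4 + t" "d v w = 3 + t"
    using d_away[of u y "2 + t" y' w] d_away[of v y "1 + t" y' w] y w Suc u L_V by auto
  thus ?case using y w adj_sym by (intro exI[of _ w] exI[of _ y]) (auto simp: algebra_simps)
qed

text \<open>The path is prolonged at its other end by \<open>r\<close> downward steps from
  \<open>u\<close>. The distance between \<open>x'\<close> and \<open>y'\<close>, next to the two
  ends, is carried along because it enters the last clause of \<open>opposite_inj\<close>.\<close>

lemma zigzag_down:
  assumes "L m u" "L (m + 1) v" "adj u v" "y \<in> V" "y' \<in> V"
    "d u y = 3 + t" "d v y = 2 + t" "d u y' = 2 + t" "d v y' = 1 + t"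
    and "3 + t + r \<le> n"
  shows "\<exists>x x'. L (m - int r) x \<and> L (m - int r + 1) x' \<and> adj x x' \<and>
    d x y = 3 + t + r \<and> d x' y = 2 + t + r \<and> d x y' = 2 + t + r \<and> d x' y' = 1 + t + r"
  using assms(10)
proof (induction r)
  case 0
  thus ?case using assms by (intro exI[of _ u] exI[of _ v]) auto
next
  case (Suc r)
  then obtain x x' where x: "L (m - int r) x" "L (m - int r + 1) x'" "adj x x'"
    "d y x = 3 + t + r" "d y x' = 2 + t + r" "d y' x = 2 + t + r" "d y' x' = 1 + t + r"
    using d_sym by (metis Suc_leD add_Suc_right)
  obtain w where w: "adj x w" "L (m - int r - 1) w" using dn_ne[OF x(1)] by (auto simp: dn_def)
  have "w \<noteq> x'"
  proof
    assume "w = x'"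
    hence "2 * int n dvd 2" using L_mod[OF x(2), of "m - int r - 1"] w by simp
    thus False using dvd_small[of 2] n_ge_3 by simp
  qed
  hence "d y w = 4 + t + r" "d y' w = 3 + t + r"
    using d_away[of y x "2 + t + r" x' w] d_away[of y' x "1 + t + r" x' w] x w Suc assms(4,5) by auto
  thus ?case using x w adj_sym d_sym[of y] d_sym[of y']
    by (intro exI[of _ w] exI[of _ x]) (auto simp: algebra_simps)
qed

text \<open>The shortest path from \<open>x\<close> to \<open>y\<close> goes up except for one step from label \<open>m + 1\<close> back to \<open>m\<close>.\<close>

lemma zigzag:
  assumes u: "L m u" "several (up m u)" and v: "L (m + 1) v" "several (dn (m + 1) v)"
    and m: "i \<le> m" "m \<le> i + int n - 3"
  shows "\<exists>x y x' y'. L i x \<and> L (i + int n - 2) y \<and> d x y = n \<and> x' \<in> up i x \<and>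
    y' \<in> dn (i + int n - 2) y \<and> d x' y' = n - 2"
proof -
  obtain u1 u2 where u12: "adj v u1" "L m u1" "adj v u2" "L m u2" "u1 \<noteq> u2"
    using v by (auto simp: several_def dn_def)
  have "several (up m u2)" using several_up u u12 by blast
  then obtain v2 where v2: "adj u2 v2" "L (m + 1) v2" "v2 \<noteq> v"
    by (auto simp: several_def up_def)
  \<comment> \<open>With \<open>r\<close> steps up from \<open>i\<close> to \<open>m\<close>, the
    three steps of the zigzag and \<open>t\<close> further steps up, the path has length
    \<open>n\<close> and ends at label \<open>i + n - 2\<close>.\<close>
  define t where "t = nat (i + int n - 3 - m)"
  define r where "r = nat (m - i)"
  have rt: "int t = i + int n - 3 - m" "int r = m - i" using m by (auto simp: t_def r_def)
  hence tr: "3 + t + r = n" by linarith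
  obtain y y' where y: "L (m + 1 + int t) y" "L (m + int t) y'" "adj y y'"
    "d u1 y = 3 + t" "d v y = 2 + t" "d u1 y' = 2 + t" "d v y' = 1 + t"
    using zigzag_up[OF u12(2) v(1) u12(4) v2(2) adj_sym[OF u12(1)] u12(3) v2(1) _ v2(3), of t]
      u12(5) tr by auto
  obtain x x' where x: "L (m - int r) x" "L (m - int r + 1) x'" "adj x x'"
    "d x y = 3 + t + r" "d x' y' = 1 + t + r"
    using zigzag_down[OF u12(2) v(1) adj_sym[OF u12(1)] L_V[OF y(1)] L_V[OF y(2)] y(4-7), of r] tr
      eq_imp_le[OF tr] by blast
  have eqs: "m - int r = i" "m + 1 + int t = i + int n - 2" "m + int t = i + int n - 2 - 1"
    "1 + t + r = n - 2"
    using rt tr by linarith+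
  show ?thesis
    using x(1-3) y(1-3) x(4,5) unfolding eqs tr up_def dn_def by blast
qed

text \<open>The only place where finiteness enters: going from \<open>i\<close> to \<open>i + n - 2\<close> around the cycle of
  labels would make the number of upper neighbours decrease forever.\<close>

lemma finite_not_all_several:
  assumes fin: "finite V"
  shows "\<exists>i x. L i x \<and> \<not> several (up i x)"
proof (rule ccontr)
  assume "\<not> ?thesis"
  hence all: "several (up i x)" if "L i x" for i x using that by blast
  \<comment> \<open>By \<open>card_up\<close> the number depends on the label only, so any vertex
    with that label may be chosen.\<close>
  define p where "p i = card (up i (SOME x. L i x))" for i
  have p: "p i = card (up i x)" if "L i x" for i x
    unfolding p_def using card_up someI[of "L i", OF that] that by blast
  \<comment> \<open>The vertex \<open>x'\<close> on a zigzag is missed by the injection between the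
    upper neighbours, so the inequality is strict.\<close>
  have less: "p (i + int n - 2) < p i" for i
  proof -
    obtain u where u: "L i u" using L_ex by blast
    obtain v where v: "L (i + 1) v" using L_ex by blast
    obtain w where w: "L (i + 1 - int n) w" using L_ex by blast
    have sd: "several (dn (i + 1) v)" using several_opposite[OF w, of v] v all[OF w] by simp
    have n3: "i \<le> i + int n - 3" using n_ge_3 by simp
    then obtain x y x' y' where xy: "L i x" "L (i + int n - 2) y" "d x y = n" "x' \<in> up i x"
      "y' \<in> dn (i + int n - 2) y" "d x' y' = n - 2"
      using zigzag[OF u all[OF u] v sd order_refl n3] by blast
    obtain \<phi> where \<phi>: "inj_on \<phi> (up (i + int n - 2) y)" "\<phi> ` up (i + int n - 2) y \<subseteq> up i x"
      "x' \<notin> \<phi> ` up (i + int n - 2) y"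
      using opposite_inj[OF xy(1-3)] xy(5,6) by metis
    have "up i x \<subseteq> V" using adj_in2 by (auto simp: up_def)
    hence "finite (up i x)" using fin by (rule finite_subset)
    moreover have "\<phi> ` up (i + int n - 2) y \<subset> up i x" using \<phi> xy(4) by blast
    ultimately show ?thesis
      using psubset_card_mono card_image[OF \<phi>(1)] p[OF xy(1)] p[OF xy(2)] by metis
  qed
  have "p (i + int k * (int n - 2)) + k \<le> p i" for k i
  proof (induction k)
    case (Suc k)
    thus ?case using less[of "i + int k * (int n - 2)"] by (simp add: algebra_simps)
  qed simp
  \<comment> \<open>After \<open>2 * n\<close> jumps of length \<open>n - 2\<close> the label is
    back at its residue, but the number has dropped by at least \<open>2 * n\<close>.\<close>
  from this[of 0 "2 * n"] have "p (2 * int n * (int n - 2)) + 2 * n \<le> p 0" by simp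
  moreover obtain x where x: "L 0 x" using L_ex by blast
  have "L (2 * int n * (int n - 2)) x \<longleftrightarrow> L 0 x" by (rule L_cong) simp
  hence "p (2 * int n * (int n - 2)) = p 0"
    using p[of 0 x] p[of "2 * int n * (int n - 2)" x] up_cong[of "2 * int n * (int n - 2)" 0 x] x by simp
  ultimately show False using n_ge_3 by simp
qed

text \<open>\<open>Z i\<close> says that label \<open>i\<close> has single upper neighbours. By
  thickness it forces several lower ones, so \<open>Z i\<close> and \<open>Z (i + n)\<close> exclude
  each other, and some \<open>i\<close> satisfies \<open>Z i\<close> but not
  \<open>Z (i - 1)\<close>. The interval starts there: the injection yields its other end
  \<open>i + n - 2\<close>, and from that end one descends, since a failure at \<open>m\<close>
  after \<open>Z (m + 1)\<close> would allow a zigzag and hence two upper neighbours at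
  \<open>i\<close>.\<close>

lemma thin_interval:
  assumes thick: "\<And>x. x \<in> V \<Longrightarrow> \<exists>a b c. adj x a \<and> adj x b \<and> adj x c \<and> distinct [a, b, c]"
    and not_all: "L i0 x0" "\<not> several (up i0 x0)"
  shows "\<exists>i. \<forall>j x. i \<le> j \<and> j \<le> i + int n - 2 \<and> L j x \<longrightarrow> \<not> several (up j x)"
proof -
  define Z where "Z i \<longleftrightarrow> (\<forall>x. L i x \<longrightarrow> \<not> several (up i x))" for i
  have Z: "Z i" if "L i x" "\<not> several (up i x)" for i x
    unfolding Z_def using that several_up by blast
  have dn_several: "several (dn i x)" if zx: "Z i" "L i x" for i x
  proof -
    obtain a b c where abc: "adj x a" "adj x b" "adj x c" "distinct [a, b, c]"
      using thick L_V[OF zx(2)] by blast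
    have "\<not> several (up i x)" using zx by (auto simp: Z_def)
    thus ?thesis using nbr_cases[OF zx(2)] abc unfolding several_def by (metis distinct_length_2_or_more)
  qed
  have opp: "\<not> Z (i + int n)" if "Z i" for i
  proof
    assume "Z (i + int n)"
    obtain x y where x: "L i x" and y: "L (i + int n) y" using L_ex by blast
    show False
      using dn_several[OF \<open>Z (i + int n)\<close> y] several_opposite[OF x y] that x by (auto simp: Z_def)
  qed
  have "\<exists>i. Z i \<and> \<not> Z (i - 1)"
  proof (rule ccontr)
    assume neg: "\<not> ?thesis"
    have "Z (i0 - int k)" for k
    proof (induction k)
      case (Suc k)
      hence "Z (i0 - int k - 1)" using neg by blast
      thus ?case by (simp add: algebra_simps)
    qed (use Z not_all in simp)
    hence "Z (i0 - int n)" "Z (i0 - int n + int n)" using Z not_all by auto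
    thus False using opp by blast
  qed
  then obtain i where i: "Z i" "\<not> Z (i - 1)" by blast
  obtain u where "L (i - 1) u" "several (up (i - 1) u)" using i(2) by (auto simp: Z_def)
  then obtain x y where xy: "L i x" "L (i + int n - 2) y" "d x y = n"
    using opposite_exists by blast
  have nx: "\<not> several (up i x)" using i(1) xy by (auto simp: Z_def)
  have "Z (i + int n - 2)"
    using opposite_inj[OF xy] several_inj nx Z[OF xy(2)] by metis
  have down: "Z (i + int n - 2 - int r)" if "r \<le> n - 2" for r
    using that
  proof (induction r)
    case 0
    thus ?case using \<open>Z (i + int n - 2)\<close> by simp
  next
    case (Suc r)
    define m where "m = i + int n - 2 - int (Suc r)"
    have m: "i \<le> m" "m \<le> i + int n - 3" using Suc n_ge_3 by (auto simp: m_def)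
    have eq: "m + 1 = i + int n - 2 - int r" by (simp add: m_def)
    have m3: "Z (m + 1)" unfolding eq by (rule Suc.IH) (use Suc.prems in simp)
    have "Z m"
    proof (rule ccontr)
      assume "\<not> Z m"
      then obtain w where w: "L m w" "several (up m w)" by (auto simp: Z_def)
      obtain v where v: "L (m + 1) v" using L_ex by blast
      obtain a b a' b' where ab: "L i a" "L (i + int n - 2) b" "d a b = n" "a' \<in> up i a"
        "b' \<in> dn (i + int n - 2) b" "d a' b' = n - 2"
        using zigzag[OF w v dn_several[OF m3 v] m(1,2)] by blast
      obtain \<phi> where \<phi>: "\<phi> ` up (i + int n - 2) b \<subseteq> up i a" "a' \<notin> \<phi> ` up (i + int n - 2) b"
        using opposite_inj[OF ab(1-3)] ab(5,6) by metis
      obtain b'' where "b'' \<in> up (i + int n - 2) b" using up_ne[OF ab(2)] by blast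
      hence "several (up i a)" using \<phi> ab(4) unfolding several_def by blast
      thus False using i(1) ab(1) by (auto simp: Z_def)
    qed
    thus ?case by (simp add: m_def)
  qed
  have "Z j" if j: "i \<le> j" "j \<le> i + int n - 2" for j
  proof -
    have "i + int n - 2 - int (nat (i + int n - 2 - j)) = j" using j by simp
    thus ?thesis using down[of "nat (i + int n - 2 - j)"] j n_ge_3 by (simp add: nat_le_iff)
  qed
  thus ?thesis unfolding Z_def by blast
qed

text \<open>\<open>c\<close> is the label just after the thin interval. Matching with opposite
  vertices makes lower neighbours unique at labels \<open>c + 1\<close> to \<open>c + n - 1\<close>,
  so a vertex labelled \<open>c + n - 1\<close> has only one downward path to label
  \<open>c\<close>; yet it is at distance \<open>n - 1\<close> from every vertex labelled
  \<open>c\<close>.\<close>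

lemma singleton_label:
  assumes thick: "\<And>x. x \<in> V \<Longrightarrow> \<exists>a b c. adj x a \<and> adj x b \<and> adj x c \<and> distinct [a, b, c]"
    and not_all: "L i0 x0" "\<not> several (up i0 x0)"
  shows "\<exists>c e. \<forall>x. L c x \<longleftrightarrow> x = e"
proof -
  obtain i where i: "\<And>j x. i \<le> j \<Longrightarrow> j \<le> i + int n - 2 \<Longrightarrow> L j x \<Longrightarrow> \<not> several (up j x)"
    using thin_interval[OF assms] by blast
  define c where "c = i + int n - 1"
  have dn1: "\<not> several (dn (c + int t) y)" if t: "1 \<le> t" "t \<le> n - 1" "L (c + int t) y" for t y
  proof -
    obtain x where x: "L (i - 1 + int t) x" using L_ex by blast
    have eq: "c + int t = i - 1 + int t + int n" by (simp add: c_def)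
    have "\<not> several (up (i - 1 + int t) x)" using i[OF _ _ x] t by linarith
    thus ?thesis using several_opposite[OF x t(3)[unfolded eq]] unfolding eq by blast
  qed
  have uniq: "x = x'" if cx: "L c x" "L c x'" and that: "L (c + int t) y" "d x y = t" "d x' y = t" "t \<le> n - 1" for x x' y t
    using that
  proof (induction t arbitrary: y)
    case 0
    thus ?case using d_eq_0 L_V cx by auto
  next
    case (Suc t)
    have tn: "int t + 2 \<le> int n" using Suc(5) n_ge_3 by linarith
    \<comment> \<open>If the step from \<open>y\<close> to \<open>z\<close> went up, the labels
      would put \<open>z\<close> at distance at least \<open>t + 2\<close> from
      \<open>w\<close>.\<close>
    have *: "z \<in> dn (c + int (Suc t)) y" if w: "L c w" "adj y z" "d w z = t" for w z
      using nbr_cases[OF Suc(2) w(2)] L_far[OF w(1), of "c + int (Suc t) + 1" z "int t + 2"] w(3) tn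
        by (auto simp: up_def)
    obtain z where z: "adj y z" "d x z = t" using d_pred[of x y t] Suc(3,4) L_V[OF cx(1)] L_V[OF Suc(2)] by blast
    obtain z' where z': "adj y z'" "d x' z' = t" using d_pred[of x' y t] Suc(3,4) L_V[OF cx(2)] L_V[OF Suc(2)] by blast
    have "z = z'"
      using *[OF cx(1) z] *[OF cx(2) z'] dn1[OF _ Suc(5,2)] unfolding several_def by auto
    moreover have "L (c + int t) z" using *[OF cx(1) z] by (simp add: dn_def)
    ultimately show ?case using Suc(1)[of z] z z' Suc(5) by auto
  qed
  obtain e where e: "L c e" using L_ex by blast
  obtain y where y: "L (c + int n - 1) y" using L_ex by blast
  have "L (c + int (n - 1)) y" using y n_ge_3 by (simp add: of_nat_diff algebra_simps)
  hence "x = e" if "L c x" for x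
    using uniq[OF that e, of "n - 1" y] L_near_opposite[OF that y] L_near_opposite[OF e y] by simp
  thus ?thesis using e by blast
qed

text \<open>Following lower neighbours (upper ones for negative \<open>t\<close>) from
  \<open>z\<close> ends at label \<open>c\<close>, that is, at \<open>e\<close>. The labels give the
  reverse inequality.\<close>

lemma singleton_dist:
  assumes e: "\<And>x. L c x \<longleftrightarrow> x = e"
  shows "\<bar>t\<bar> \<le> int n \<Longrightarrow> L (c + t) z \<Longrightarrow> int (d e z) = \<bar>t\<bar>"
proof -
  have e': "L c e" "e \<in> V" using e L_V by blast+
  have up: "d e z \<le> k" if "L (c + int k) z" for k z
    using that
  proof (induction k arbitrary: z)
    case 0
    thus ?case using e e' by auto
  next
    case (Suc k)
    obtain w where w: "adj z w" "L (c + int k) w" using dn_ne[OF Suc(2)] by (auto simp: dn_def)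
    show ?case using Suc(1)[OF w(2)] d_step[OF e'(2) w(1)] by auto
  qed
  have dn: "d e z \<le> k" if "L (c - int k) z" for k z
    using that
  proof (induction k arbitrary: z)
    case 0
    thus ?case using e e' by auto
  next
    case (Suc k)
    obtain w where w: "adj z w" "L (c - int k) w" using up_ne[OF Suc(2)] by (auto simp: up_def)
    show ?case using Suc(1)[OF w(2)] d_step[OF e'(2) w(1)] by auto
  qed
  assume t: "\<bar>t\<bar> \<le> int n" and z: "L (c + t) z"
  have "d e z \<le> nat \<bar>t\<bar>"
    using up[of "nat \<bar>t\<bar>" z] dn[of "nat \<bar>t\<bar>" z] z by (cases "t \<ge> 0") auto
  thus ?thesis using L_dist(1)[OF e'(1) z t] by linarith
qed

lemma L_range: "x \<in> V \<Longrightarrow> \<exists>t. \<bar>t\<bar> \<le> int n \<and> L (c + t) x"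
proof -
  assume x: "x \<in> V"
  define r where "r = (lab x - c) mod (2 * int n)"
  have r: "0 \<le> r" "r < 2 * int n" "2 * int n dvd lab x - c - r"
    using n_ge_3 by (auto simp: r_def)
  have "L (c + r) x" using x r(3) by (simp add: L_def algebra_simps)
  moreover from this have "L (c + (r - 2 * int n)) x" using L_shift[of "c + r" x] by (simp add: algebra_simps)
  ultimately show ?thesis using r by (cases "r \<le> int n") force+
qed

end

section \<open>The incidence graph of a weak generalized polygon\<close>

definition adjacent :: "('p, 'l) geometry \<Rightarrow> 'p + 'l \<Rightarrow> 'p + 'l \<Rightarrow> bool" where
  "adjacent G x y \<longleftrightarrow>
    (\<exists>p l. (p, l) \<in> inc G \<and> (x = Inl p \<and> y = Inr l \<or> x = Inr l \<and> y = Inl p))"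

text \<open>\<open>LEAST\<close> is unspecified if there is no walk; between elements of a weak
  generalized polygon \<open>walk_exists\<close> supplies one.\<close>

definition gdist :: "('p, 'l) geometry \<Rightarrow> 'p + 'l \<Rightarrow> 'p + 'l \<Rightarrow> nat" where
  "gdist G x y = (LEAST k. (adjacent G ^^ k) x y)"

section \<open>Walks in the incidence graph and their parity\<close>

lemma adjacent_simps [simp]:
  "adjacent G (Inl p) (Inr l) \<longleftrightarrow> (p, l) \<in> inc G"
  "adjacent G (Inr l) (Inl p) \<longleftrightarrow> (p, l) \<in> inc G"
  "\<not> adjacent G (Inl p) (Inl q)" "\<not> adjacent G (Inr l) (Inr m)"
  by (auto simp: adjacent_def)

lemma adjacent_sym: "adjacent G x y \<Longrightarrow> adjacent G y x"
  by (auto simp: adjacent_def)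

lemma adjacent_isl: "adjacent G x y \<Longrightarrow> isl x \<longleftrightarrow> \<not> isl y"
  by (auto simp: adjacent_def)

lemma walk_sym: "(adjacent G ^^ k) x y \<Longrightarrow> (adjacent G ^^ k) y x"
proof (induction k arbitrary: y)
  case (Suc k)
  then obtain z where "(adjacent G ^^ k) x z" "adjacent G z y" by (auto elim: relpowp_Suc_E)
  thus ?case using Suc adjacent_sym relpowp_Suc_I2 by metis
qed simp

lemma walk_isl: "(adjacent G ^^ k) x y \<Longrightarrow> (isl x \<longleftrightarrow> isl y) \<longleftrightarrow> even k"
proof (induction k arbitrary: y)
  case (Suc k)
  then obtain z where "(adjacent G ^^ k) x z" "adjacent G z y" by (auto elim: relpowp_Suc_E)
  thus ?case using Suc adjacent_isl by fastforce
qed simp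

lemma gdist_sym: "gdist G x y = gdist G y x"
  unfolding gdist_def using walk_sym by metis

lemma gdist_le: "(adjacent G ^^ k) x y \<Longrightarrow> gdist G x y \<le> k"
  unfolding gdist_def by (rule Least_le)

section \<open>Ordinary polygons as circuits of the incidence graph\<close>

lemma ordinary_gon_cycle:
  assumes H: "ordinary_gon n H" and n: "2 \<le> n"
  obtains c where "\<And>i. adjacent H (c i) (c (Suc i))" "\<And>i. c (i + 2 * n) = c i"
    "elements H = c ` {..<2 * n}" "\<And>i. c (Suc i) \<noteq> c (Suc i + 2 * (n - 1))"
proof -
  obtain p l where p: "bij_betw p {..<n} (pts H)" and l: "bij_betw l {..<n} (lns H)"
    and inc: "\<And>i j. i < n \<Longrightarrow> j < n \<Longrightarrow> (p i, l j) \<in> inc H \<longleftrightarrow> i = j \<or> i = Suc j mod n"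
    using H by (auto simp: ordinary_gon_def)
  \<comment> \<open>Points stand at even and lines at odd indices, as \<open>l i\<close> meets
    \<open>p i\<close> and its successor. Periodic extension to all naturals avoids wrap-around
    cases.\<close>
  define c where "c i = (if even i then Inl (p (i div 2 mod n)) else Inr (l (i div 2 mod n)))" for i
  have pos: "0 < n" using n by simp
  have "adjacent H (c i) (c (Suc i))" for i
  proof (cases "even i")
    case True
    thus ?thesis using inc[of "i div 2 mod n" "i div 2 mod n"] pos by (simp add: c_def)
  next
    case False
    hence "Suc i div 2 = Suc (i div 2)" by presburger
    thus ?thesis using False inc[of "Suc (i div 2) mod n" "i div 2 mod n"] pos
      by (simp add: c_def mod_Suc_eq)
  qed
  moreover have "c (i + 2 * n) = c i" for i by (simp add: c_def)
  moreover have "elements H = c ` {..<2 * n}"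
  proof
    show "c ` {..<2 * n} \<subseteq> elements H"
      using p l pos by (auto simp: c_def elements_def bij_betw_def)
    show "elements H \<subseteq> c ` {..<2 * n}"
    proof
      fix x assume "x \<in> elements H"
      then consider "x \<in> Inl ` p ` {..<n}" | "x \<in> Inr ` l ` {..<n}"
        using p l unfolding elements_def bij_betw_def Plus_def by blast
      then consider i where "i < n" "x = Inl (p i)" | i where "i < n" "x = Inr (l i)"
        by cases auto
      thus "x \<in> c ` {..<2 * n}"
      proof cases
        case 1
        thus ?thesis by (intro image_eqI[of _ _ "2 * i"]) (auto simp: c_def)
      next
        case 2
        thus ?thesis by (intro image_eqI[of _ _ "Suc (2 * i)"]) (auto simp: c_def)
      qed
    qed
  qed
  \<comment> \<open>The second index is \<open>i - 1\<close> modulo \<open>2 * n\<close>, so the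
    claim is that the two neighbours of \<open>c i\<close> on the circuit differ.\<close>
  moreover have "c (Suc i) \<noteq> c (Suc i + 2 * (n - 1))" for i
  proof
    assume eq: "c (Suc i) = c (Suc i + 2 * (n - 1))"
    have inj: "inj_on p {..<n}" "inj_on l {..<n}" using p l by (auto simp: bij_betw_def)
    let ?a = "Suc i div 2"
    have div: "(Suc i + 2 * (n - 1)) div 2 = ?a + (n - 1)" by simp
    have "?a mod n = (?a + (n - 1)) mod n"
      using eq inj pos unfolding c_def div by (auto simp: inj_on_def split: if_splits)
    hence "n dvd n - 1" using mod_eq_dvd_iff_nat[of ?a "?a + (n - 1)" n] by auto
    thus False using n by (auto dest: dvd_imp_le)
  qed
  ultimately show thesis by (rule that)
qed

text \<open>The equivalence excludes chords, which matters because a subgeometry carries the full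
  induced incidence.\<close>

lemma induced_cycle_ordinary:
  assumes k: "2 \<le> k" and G: "point_line_geometry G" and inj: "inj_on c {..<2 * k}"
    and adj: "\<And>i j. i < 2 * k \<Longrightarrow> j < 2 * k \<Longrightarrow>
      adjacent G (c i) (c j) \<longleftrightarrow> j = Suc i mod (2 * k) \<or> i = Suc j mod (2 * k)"
    and c0: "isl (c 0)"
  shows "\<exists>H. subgeometry H G \<and> ordinary_gon k H"
proof -
  have isl: "isl (c i) \<longleftrightarrow> even i" if "i < 2 * k" for i
    using that
  proof (induction i)
    case (Suc i)
    thus ?case using adjacent_isl[of G "c i" "c (Suc i)"] adj[of i "Suc i"] by auto
  qed (use c0 in simp)
  define p where "p i = projl (c (2 * i))" for i
  define l where "l i = projr (c (2 * i + 1))" for i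
  have p: "c (2 * i) = Inl (p i)" if "i < k" for i
    using isl[of "2 * i"] that by (simp add: p_def)
  have l: "c (2 * i + 1) = Inr (l i)" if "i < k" for i
    using isl[of "2 * i + 1"] that by (simp add: l_def)
  have inc: "(p i, l j) \<in> inc G \<longleftrightarrow> i = j \<or> i = Suc j mod k" if "i < k" "j < k" for i j
  proof -
    have "(p i, l j) \<in> inc G \<longleftrightarrow> adjacent G (c (2 * i)) (c (2 * j + 1))" using p l that by simp
    also have "\<dots> \<longleftrightarrow> 2 * j + 1 = Suc (2 * i) mod (2 * k) \<or> 2 * i = Suc (2 * j + 1) mod (2 * k)"
      using adj[of "2 * i" "2 * j + 1"] that by simp
    also have "Suc (2 * i) mod (2 * k) = 2 * i + 1" using that by simp
    also have "Suc (2 * j + 1) mod (2 * k) = 2 * (Suc j mod k)" using mult_mod_right[of 2 "Suc j" k] by simp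
    finally show ?thesis by auto
  qed
  have "inj_on p {..<k}"
  proof (rule inj_onI)
    fix i j assume "i \<in> {..<k}" "j \<in> {..<k}" "p i = p j"
    thus "i = j" using inj_onD[OF inj, of "2 * i" "2 * j"] p by auto
  qed
  moreover have "inj_on l {..<k}"
  proof (rule inj_onI)
    fix i j assume "i \<in> {..<k}" "j \<in> {..<k}" "l i = l j"
    thus "i = j" using inj_onD[OF inj, of "2 * i + 1" "2 * j + 1"] l by auto
  qed
  moreover define H where "H = \<lparr>pts = p ` {..<k}, lns = l ` {..<k},
    inc = inc G \<inter> (p ` {..<k} \<times> l ` {..<k})\<rparr>"
  moreover have "p i \<in> pts G \<and> l i \<in> lns G" if "i < k" for i
    using inc[OF that that] G by (auto simp: point_line_geometry_def)
  ultimately have "subgeometry H G" "point_line_geometry H"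
    "bij_betw p {..<k} (pts H)" "bij_betw l {..<k} (lns H)"
    "\<forall>i<k. \<forall>j<k. (p i, l j) \<in> inc H \<longleftrightarrow> i = j \<or> i = Suc j mod k"
    using inc by (auto simp: subgeometry_def point_line_geometry_def bij_betw_def)
  thus ?thesis unfolding ordinary_gon_def by blast
qed

text \<open>A circuit that starts at a line is rotated by one place.\<close>

lemma induced_cycle_ordinary':
  assumes k: "2 \<le> k" and G: "point_line_geometry G" and inj: "inj_on c {..<2 * k}"
    and adj: "\<And>i j. i < 2 * k \<Longrightarrow> j < 2 * k \<Longrightarrow>
      adjacent G (c i) (c j) \<longleftrightarrow> j = Suc i mod (2 * k) \<or> i = Suc j mod (2 * k)"
  shows "\<exists>H. subgeometry H G \<and> ordinary_gon k H"
proof (cases "isl (c 0)")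
  case True
  thus ?thesis using induced_cycle_ordinary assms by blast
next
  case False
  have S: "Suc i mod (2 * k) < 2 * k" for i using k by simp
  have eq: "Suc i mod (2 * k) = Suc j mod (2 * k) \<longleftrightarrow> i = j" if "i < 2 * k" "j < 2 * k" for i j
    using that k by (auto simp: mod_Suc)
  show ?thesis
  proof (rule induced_cycle_ordinary[OF k G, of "\<lambda>i. c (Suc i mod (2 * k))"])
    show "inj_on (\<lambda>i. c (Suc i mod (2 * k))) {..<2 * k}"
    proof (rule inj_onI)
      fix i j assume "i \<in> {..<2 * k}" "j \<in> {..<2 * k}"
        "c (Suc i mod (2 * k)) = c (Suc j mod (2 * k))"
      thus "i = j" using inj_onD[OF inj, of "Suc i mod (2 * k)" "Suc j mod (2 * k)"] eq[of i j] S by simp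
    qed
    show "adjacent G (c (Suc i mod (2 * k))) (c (Suc j mod (2 * k))) \<longleftrightarrow>
      j = Suc i mod (2 * k) \<or> i = Suc j mod (2 * k)" if "i < 2 * k" "j < 2 * k" for i j
      using adj[OF S[of i] S[of j]] eq[OF that(2) S[of i]] eq[OF that(1) S[of j]] by simp
    show "isl (c (Suc 0 mod (2 * k)))"
      using adjacent_isl[of G "c 0" "c 1"] adj[of 0 1] False k by auto
  qed
qed

section \<open>Distances in a weak generalized polygon\<close>

locale weak_gon =
  fixes n :: nat and G :: "('p, 'l) geometry"
  assumes weak: "weak_generalized_gon n G"
begin

lemma geometry: "point_line_geometry G" and n3: "3 \<le> n"
  using weak by (auto simp: weak_generalized_gon_def)

lemma adjacent_in: "adjacent G x y \<Longrightarrow> x \<in> elements G"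
  using geometry by (auto simp: adjacent_def elements_def point_line_geometry_def)

lemma common_gon:
  assumes "x \<in> elements G" "y \<in> elements G"
  obtains c i j where "\<And>i. adjacent G (c i) (c (Suc i))" "\<And>i. c (i + 2 * n) = c i"
    "x = c i" "y = c j" "i < 2 * n" "j < 2 * n" "\<And>i. c (Suc i) \<noteq> c (Suc i + 2 * (n - 1))"
proof -
  obtain H where H: "subgeometry H G" "ordinary_gon n H" "x \<in> elements H" "y \<in> elements H"
    using weak assms unfolding weak_generalized_gon_def by blast
  have "2 \<le> n" using n3 by simp
  from ordinary_gon_cycle[OF H(2) this] obtain c where c: "\<And>i. adjacent H (c i) (c (Suc i))"
    "\<And>i. c (i + 2 * n) = c i" "elements H = c ` {..<2 * n}"
    "\<And>i. c (Suc i) \<noteq> c (Suc i + 2 * (n - 1))" by metis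
  obtain i j where "x = c i" "y = c j" "i < 2 * n" "j < 2 * n" using c(3) H by auto
  moreover have "adjacent G (c i) (c (Suc i))" for i
    using c(1)[of i] H(1) by (auto simp: adjacent_def subgeometry_def)
  ultimately show thesis using that c by blast
qed

lemma walk_exists:
  assumes "x \<in> elements G" "y \<in> elements G"
  shows "\<exists>k \<le> n. (adjacent G ^^ k) x y"
proof -
  obtain c i j where c: "\<And>i. adjacent G (c i) (c (Suc i))" "\<And>i. c (i + 2 * n) = c i"
    and ij: "x = c i" "y = c j" "i < 2 * n" "j < 2 * n" using common_gon[OF assms] by metis
  have w: "(adjacent G ^^ k) (c i) (c (i + k))" for i k
    by (induction k) (use c(1) in auto)
  \<comment> \<open>Of the two arcs between two vertices of a circuit of length
    \<open>2 * n\<close>, one has length at most \<open>n\<close>.\<close>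
  have *: "\<exists>k \<le> n. (adjacent G ^^ k) (c i) (c j)" if "i \<le> j" "j < 2 * n" for i j
  proof (cases "j - i \<le> n")
    case True
    thus ?thesis using w[of "j - i" i] that by auto
  next
    case False
    have "(adjacent G ^^ (2 * n - (j - i))) (c j) (c i)"
      using w[of "2 * n - (j - i)" j] c(2)[of i] that by (simp add: add.commute)
    moreover have "2 * n - (j - i) \<le> n" using False by simp
    ultimately show ?thesis using walk_sym by blast
  qed
  show ?thesis
  proof (cases "i \<le> j")
    case True
    thus ?thesis using *[of i j] ij by simp
  next
    case False
    then obtain k where "k \<le> n" "(adjacent G ^^ k) (c j) (c i)" using *[of j i] ij by auto
    thus ?thesis using ij walk_sym by blast
  qed
qed

lemma gdist_walk:
  assumes "x \<in> elements G" "y \<in> elements G"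
  shows "(adjacent G ^^ gdist G x y) x y"
  unfolding gdist_def using walk_exists[OF assms] by (metis LeastI)

lemma gdist_le_n: "x \<in> elements G \<Longrightarrow> y \<in> elements G \<Longrightarrow> gdist G x y \<le> n"
  using walk_exists gdist_le le_trans by blast

lemma gdist_triangle:
  assumes "x \<in> elements G" "y \<in> elements G" "z \<in> elements G"
  shows "gdist G x z \<le> gdist G x y + gdist G y z"
  using gdist_walk[OF assms(1,2)] gdist_walk[OF assms(2,3)]
  by (intro gdist_le) (auto simp: relpowp_add)

lemma gdist_parity:
  assumes "x \<in> elements G" "y \<in> elements G"
  shows "(isl x \<longleftrightarrow> isl y) \<longleftrightarrow> even (gdist G x y)"
  using walk_isl[OF gdist_walk[OF assms]] .

lemma gdist_self: "gdist G x x = 0"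
  using gdist_le[of 0 G x x] by simp

lemma gdist_step:
  assumes "x \<in> elements G" "adjacent G y z"
  shows "gdist G x z = Suc (gdist G x y) \<or> gdist G x y = Suc (gdist G x z)"
proof -
  have V: "y \<in> elements G" "z \<in> elements G" using assms adjacent_in adjacent_sym by blast+
  have "(adjacent G ^^ 1) y z" "(adjacent G ^^ 1) z y" using assms adjacent_sym by auto
  hence "gdist G y z \<le> 1" "gdist G z y \<le> 1" by (blast intro: gdist_le)+
  hence "gdist G x z \<le> gdist G x y + 1" "gdist G x y \<le> gdist G x z + 1"
    using gdist_triangle[OF assms(1) V] gdist_triangle[OF assms(1) V(2,1)] by linarith+
  moreover have "even (gdist G x z) \<noteq> even (gdist G x y)"
    using gdist_parity assms V adjacent_isl[OF assms(2)] by blast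
  ultimately show ?thesis by presburger
qed

lemma gdist_pred:
  assumes "x \<in> elements G" "y \<in> elements G" "gdist G x y = Suc k"
  shows "\<exists>z. adjacent G y z \<and> gdist G x z = k"
proof -
  have "(adjacent G ^^ Suc k) x y" using gdist_walk[OF assms(1,2)] assms by simp
  then obtain z where "(adjacent G ^^ k) x z" "adjacent G z y" by (rule relpowp_Suc_E)
  thus ?thesis using gdist_le gdist_step[OF assms(1), of z y] assms(3) adjacent_sym by force
qed

text \<open>The path runs from \<open>x\<close> to \<open>z\<close> and on to \<open>y\<close>. Its
  length is the distance \<open>k\<close> of its ends, so all its initial and final sections are
  shortest as well.\<close>

lemma geodesic:
  assumes x: "x \<in> elements G" and y: "adjacent G y z" and k: "gdist G x y = k" "Suc (gdist G x z) = k"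
  obtains a where "a 0 = x" "a k = y" "a (k - 1) = z" "\<And>i. i < k \<Longrightarrow> adjacent G (a i) (a (Suc i))"
    "\<And>i. i \<le> k \<Longrightarrow> a i \<in> elements G \<and> gdist G x (a i) = i \<and> gdist G (a i) y = k - i"
proof -
  have V: "y \<in> elements G" "z \<in> elements G" using y adjacent_in adjacent_sym by blast+
  have "(adjacent G ^^ (k - 1)) x z"
    using gdist_walk[OF x V(2)] k(2) by (metis diff_Suc_1)
  then obtain b where b: "b 0 = x" "b (k - 1) = z" "\<And>i. i < k - 1 \<Longrightarrow> adjacent G (b i) (b (Suc i))"
    unfolding relpowp_fun_conv by blast
  define a where "a = b(k := y)"
  have a: "a 0 = x" "a k = y" "a (k - 1) = z" using b k by (auto simp: a_def)
  have adj: "adjacent G (a i) (a (Suc i))" if "i < k" for i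
    using b(3)[of i] b(2) y that adjacent_sym[OF y] by (cases "i = k - 1") (auto simp: a_def)
  have V': "a i \<in> elements G" if "i \<le> k" for i
    using adj[of i] adjacent_in[of "a i"] a(2) V that by (cases "i = k") auto
  have le: "gdist G (a i) (a j) \<le> j - i" if "i \<le> j" "j \<le> k" for i j
  proof (rule gdist_le)
    show "(adjacent G ^^ (j - i)) (a i) (a j)"
      unfolding relpowp_fun_conv using adj that by (intro exI[of _ "\<lambda>m. a (i + m)"]) auto
  qed
  have "gdist G x (a i) = i \<and> gdist G (a i) y = k - i" if "i \<le> k" for i
    using le[of 0 i] le[of i k] gdist_triangle[OF x V'[OF that] V(1)] k(1) a that by auto
  thus thesis using that[OF a adj] V' by blast
qed

text \<open>Two different first steps from \<open>y\<close> towards \<open>x\<close>, with \<open>gdist G x y = k\<close> minimal, close up to an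
  induced cycle of length \<open>2 * k\<close>.\<close>

lemma gdist_unique:
  assumes "x \<in> elements G" "gdist G x y = k" "k < n" "adjacent G y z" "adjacent G y z'"
    "Suc (gdist G x z) = k" "Suc (gdist G x z') = k"
  shows "z = z'"
  using assms
proof (induction k arbitrary: x y z z' rule: less_induct)
  case (less k)
  show ?case
  proof (rule ccontr)
    assume ne: "z \<noteq> z'"
    obtain a where a: "a 0 = x" "a k = y" "a (k - 1) = z" "\<And>i. i < k \<Longrightarrow> adjacent G (a i) (a (Suc i))"
      "\<And>i. i \<le> k \<Longrightarrow> a i \<in> elements G \<and> gdist G x (a i) = i \<and> gdist G (a i) y = k - i"
      using geodesic[OF less(2,5,3,7)] by blast
    obtain b where b: "b 0 = x" "b k = y" "b (k - 1) = z'" "\<And>i. i < k \<Longrightarrow> adjacent G (b i) (b (Suc i))"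
      "\<And>i. i \<le> k \<Longrightarrow> b i \<in> elements G \<and> gdist G x (b i) = i \<and> gdist G (b i) y = k - i"
      using geodesic[OF less(2,6,3,8)] by blast
    have y: "y \<in> elements G" using less(5) adjacent_in by blast
    have k2: "2 \<le> k"
    proof (rule ccontr)
      assume "\<not> 2 \<le> k"
      hence "k = 1" using less(7) by linarith
      thus False using a b ne by simp
    qed
    \<comment> \<open>From a common inner vertex there would again be two steps \<open>z\<close> and
      \<open>z'\<close>, now at the smaller distance \<open>k - i\<close>, against the induction
      hypothesis.\<close>
    have ab: "a i \<noteq> b i" if i: "0 < i" "i < k" for i
    proof
      assume eq: "a i = b i"
      show False
      proof (cases "i = k - 1")
        case True
        thus False using eq a b ne by simp
      next
        case False
        hence i': "i < k - 1" using i by linarith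
        have "gdist G y (a i) = k - i" "gdist G (a i) y = k - i"
          using a(5)[of i] i gdist_sym[of G y] by auto
        moreover have "Suc (gdist G (a i) z) = k - i" "Suc (gdist G (a i) z') = k - i"
        proof -
          have 1: "gdist G x z \<le> gdist G x (a i) + gdist G (a i) z"
            "gdist G x z' \<le> gdist G x (a i) + gdist G (a i) z'"
            using gdist_triangle less(2,5,6) a(5)[of i] i adjacent_in adjacent_sym
            by (meson less_imp_le)+
          have "(adjacent G ^^ (k - 1 - i)) (a i) (a (k - 1))"
            unfolding relpowp_fun_conv using a(4) i' by (intro exI[of _ "\<lambda>m. a (i + m)"]) auto
          moreover have "(adjacent G ^^ (k - 1 - i)) (b i) (b (k - 1))"
            unfolding relpowp_fun_conv using b(4) i' by (intro exI[of _ "\<lambda>m. b (i + m)"]) auto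
          ultimately have "gdist G (a i) z \<le> k - 1 - i" "gdist G (a i) z' \<le> k - 1 - i"
            using gdist_le a(3) b(3) eq by metis+
          thus "Suc (gdist G (a i) z) = k - i" "Suc (gdist G (a i) z') = k - i"
            using 1 a(5)[of i] i less(7,8) by linarith+
        qed
        ultimately have "z = z'"
          using less(1)[of "k - i" "a i" y z z'] less(4-6) a(5)[of i] i by auto
        thus False using ne by simp
      qed
    qed
    \<comment> \<open>The circuit runs along \<open>a\<close> from \<open>x\<close> to
      \<open>y\<close> and back along \<open>b\<close>.\<close>
    define c where "c i = (if i \<le> k then a i else b (2 * k - i))" for i
    have lev: "gdist G x (c i) = min i (2 * k - i)" if "i < 2 * k" for i
      using a(5)[of i] b(5)[of "2 * k - i"] that by (auto simp: c_def min_def)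
    have inj: "inj_on c {..<2 * k}"
    proof (rule linorder_inj_onI')
      fix i j assume ij: "i \<in> {..<2 * k}" "j \<in> {..<2 * k}" "i < j"
      show "c i \<noteq> c j"
      proof
        assume eq: "c i = c j"
        hence j: "2 * k - j = i" using lev[of i] lev[of j] ij by (auto simp: min_def split: if_splits)
        hence "a i = b i" "0 < i" "i < k" using eq ij by (auto simp: c_def split: if_splits)
        thus False using ab by blast
      qed
    qed
    \<comment> \<open>A chord from \<open>a i\<close> to \<open>b (Suc i)\<close> with
      \<open>Suc i < k\<close> would make \<open>a i\<close> and \<open>b i\<close> two steps from
      \<open>b (Suc i)\<close> towards \<open>x\<close>, so by induction \<open>a i = b i\<close>;
      other chords are symmetric or join vertices whose distances from \<open>x\<close> do not
      differ by one.\<close>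
    have cross: "j = Suc i \<and> j = k \<or> i = 0 \<and> j = 1 \<or> i = Suc j \<and> i = k \<or> j = 0 \<and> i = 1"
      if "i \<le> k" "j \<le> k" "adjacent G (a i) (b j)" for i j
    proof -
      have V: "a i \<in> elements G" "b j \<in> elements G" using a(5) b(5) that by auto
      have "j = Suc i \<or> i = Suc j" using gdist_step[OF less(2) that(3)] a(5) b(5) that by auto
      moreover have "i = 0 \<or> j = k" if j: "j = Suc i"
      proof (rule ccontr)
        assume neg: "\<not> ?thesis"
        hence "a i = b i"
          using less(1)[of j x "b j" "a i" "b i"] a(5)[of i] b(5)[of i] b(5)[of j] b(4)[of i]
            adjacent_sym that j less(2,4) \<open>i \<le> k\<close> \<open>j \<le> k\<close> \<open>adjacent G (a i) (b j)\<close> by auto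
        thus False using ab[of i] neg j \<open>j \<le> k\<close> by auto
      qed
      moreover have "j = 0 \<or> i = k" if i: "i = Suc j"
      proof (rule ccontr)
        assume neg: "\<not> ?thesis"
        hence "a j = b j"
          using less(1)[of i x "a i" "a j" "b j"] a(5)[of i] a(5)[of j] b(5)[of j] a(4)[of j]
            adjacent_sym that i less(2,4) \<open>i \<le> k\<close> \<open>j \<le> k\<close> \<open>adjacent G (a i) (b j)\<close> by auto
        thus False using ab[of j] neg i \<open>i \<le> k\<close> by auto
      qed
      ultimately show ?thesis by auto
    qed
    have step: "adjacent G (c i) (c (Suc i mod (2 * k)))" if il: "i < 2 * k" for i
    proof -
      consider "i < k" | "i = k" | "k < i" "Suc i < 2 * k" | "k < i" "Suc i = 2 * k"
        using il by linarith
      thus ?thesis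
      proof cases
        case 1
        thus ?thesis using a(4)[of i] by (simp add: c_def)
      next
        case 2
        thus ?thesis using b(4)[of "k - 1"] a(2) b(2) k2 adjacent_sym by (auto simp: c_def)
      next
        case 3
        hence "2 * k - i = Suc (2 * k - Suc i)" by simp
        moreover have "2 * k - Suc i < k" using 3 by linarith
        ultimately have "adjacent G (b (2 * k - i)) (b (2 * k - Suc i))"
          using b(4)[of "2 * k - Suc i"] adjacent_sym by metis
        thus ?thesis using 3 by (simp add: c_def)
      next
        case 4
        hence "2 * k - i = Suc 0" by simp
        thus ?thesis using 4 b(4)[of 0] a(1) b(1) adjacent_sym k2 by (auto simp: c_def)
      qed
    qed
    have adj: "adjacent G (c i) (c j) \<longleftrightarrow> j = Suc i mod (2 * k) \<or> i = Suc j mod (2 * k)"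
      if ij: "i < 2 * k" "j < 2 * k" for i j
    proof
      assume "j = Suc i mod (2 * k) \<or> i = Suc j mod (2 * k)"
      thus "adjacent G (c i) (c j)" using step ij adjacent_sym by blast
    next
      assume adj: "adjacent G (c i) (c j)"
      have l: "min j (2 * k - j) = Suc (min i (2 * k - i)) \<or> min i (2 * k - i) = Suc (min j (2 * k - j))"
        using gdist_step[OF less(2) adj] lev ij by auto
      consider "i \<le> k" "j \<le> k" | "k < i" "k < j" | "i \<le> k" "k < j" | "k < i" "j \<le> k" by linarith
      thus "j = Suc i mod (2 * k) \<or> i = Suc j mod (2 * k)"
      proof cases
        case 1
        thus ?thesis using l ij by (auto simp: min_def split: if_splits)
      next
        case 2
        thus ?thesis using l ij by (auto simp: min_def split: if_splits)
      next
        case 3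
        hence "adjacent G (a i) (b (2 * k - j))" using adj by (simp add: c_def)
        hence "2 * k - j = Suc i \<and> 2 * k - j = k \<or> i = 0 \<and> 2 * k - j = 1 \<or>
          i = Suc (2 * k - j) \<and> i = k \<or> 2 * k - j = 0 \<and> i = 1"
          using cross[of i "2 * k - j"] 3 by auto
        hence "i = 0 \<and> Suc j = 2 * k \<or> i = k \<and> j = Suc k" using 3 ij by linarith
        thus ?thesis using k2 by auto
      next
        case 4
        hence "adjacent G (a j) (b (2 * k - i))" using adj adjacent_sym by (simp add: c_def)
        hence "2 * k - i = Suc j \<and> 2 * k - i = k \<or> j = 0 \<and> 2 * k - i = 1 \<or>
          j = Suc (2 * k - i) \<and> j = k \<or> 2 * k - i = 0 \<and> j = 1"
          using cross[of j "2 * k - i"] 4 by auto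
        hence "j = 0 \<and> Suc i = 2 * k \<or> j = k \<and> i = Suc k" using 4 ij by linarith
        thus ?thesis using k2 by auto
      qed
    qed
    have "\<exists>H. subgeometry H G \<and> ordinary_gon k H"
      by (rule induced_cycle_ordinary'[OF k2 geometry inj adj])
    thus False using weak k2 less(4) by (auto simp: weak_generalized_gon_def)
  qed
qed

lemma two_neighbours:
  assumes "x \<in> elements G"
  shows "\<exists>y z. adjacent G x y \<and> adjacent G x z \<and> y \<noteq> z"
proof -
  obtain c i where c: "\<And>i. adjacent G (c i) (c (Suc i))" "\<And>i. c (i + 2 * n) = c i" "x = c i"
    "\<And>i. c (Suc i) \<noteq> c (Suc i + 2 * (n - 1))" using common_gon[OF assms assms] by metis
  have "Suc (Suc i + 2 * (n - 1)) = i + 2 * n" using n3 by simp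
  hence "adjacent G (c (Suc i + 2 * (n - 1))) x" using c(1)[of "Suc i + 2 * (n - 1)"] c(2,3) by metis
  thus ?thesis using c(1)[of i] c(3) c(4)[of i] adjacent_sym by metis
qed

end

sublocale weak_gon \<subseteq> polygon "elements G" "adjacent G" "gdist G" n
proof
  show "3 \<le> n" by (rule n3)
  show "adjacent G x y \<Longrightarrow> adjacent G y x" for x y by (rule adjacent_sym)
  show "adjacent G x y \<Longrightarrow> x \<in> elements G" for x y by (rule adjacent_in)
  show "gdist G x y = gdist G y x" for x y by (rule gdist_sym)
  show "gdist G x y = 0 \<longleftrightarrow> x = y" if "x \<in> elements G" "y \<in> elements G" for x y
    using gdist_walk[OF that] gdist_self by auto
  show "gdist G x z = Suc (gdist G x y) \<or> gdist G x y = Suc (gdist G x z)"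
    if "x \<in> elements G" "adjacent G y z" for x y z by (rule gdist_step[OF that])
  show "z = z'" if "x \<in> elements G" "gdist G x y = Suc k" "Suc k < n" "adjacent G y z"
    "adjacent G y z'" "gdist G x z = k" "gdist G x z' = k" for x y k z z'
    using gdist_unique[OF that(1-5)] that(6,7) by simp
qed (use gdist_le_n gdist_pred two_neighbours in auto)

section \<open>Epimorphisms onto thin polygons\<close>

lemma ecard_ge_3: "3 \<le> ecard A \<longleftrightarrow> (\<exists>a b c. a \<in> A \<and> b \<in> A \<and> c \<in> A \<and> distinct [a, b, c])"
proof
  assume *: "3 \<le> ecard A"
  have "\<exists>B \<subseteq> A. card B = 3"
  proof (cases "finite A")
    case True
    hence "3 \<le> card A" using * by (simp add: ecard_def numeral_eq_enat)
    thus ?thesis by (meson obtain_subset_with_card_n)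
  next
    case False
    thus ?thesis using infinite_arbitrarily_large by metis
  qed
  then obtain B where "B \<subseteq> A" "card B = 3" by blast
  thus "\<exists>a b c. a \<in> A \<and> b \<in> A \<and> c \<in> A \<and> distinct [a, b, c]"
    unfolding card_3_iff by force
next
  assume "\<exists>a b c. a \<in> A \<and> b \<in> A \<and> c \<in> A \<and> distinct [a, b, c]"
  then obtain a b c where abc: "{a, b, c} \<subseteq> A" "distinct [a, b, c]" by blast
  hence c3: "card {a, b, c} = 3" by auto
  show "3 \<le> ecard A"
  proof (cases "finite A")
    case True
    hence "3 \<le> card A" using card_mono[OF True abc(1)] c3 by simp
    thus ?thesis using True by (simp add: ecard_def numeral_eq_enat)
  qed (simp add: ecard_def)
qed

section \<open>Sub polygons and chains\<close>

lemma elements_simps [simp]: "Inl p \<in> elements G \<longleftrightarrow> p \<in> pts G" "Inr l \<in> elements G \<longleftrightarrow> l \<in> lns G"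
  by (auto simp: elements_def)

lemma elements_subgeometry: "subgeometry H G \<Longrightarrow> elements H \<subseteq> elements G"
  by (auto simp: elements_def subgeometry_def)

lemma adjacent_subgeometry:
  "subgeometry H G \<Longrightarrow> adjacent H x y \<longleftrightarrow> adjacent G x y \<and> x \<in> elements H \<and> y \<in> elements H"
  by (auto simp: adjacent_def subgeometry_def)

text \<open>A larger set is contained in fewer sub polygons, so the intersection grows.\<close>

lemma generated_mono: "S \<subseteq> T \<Longrightarrow> elements (generated n G S) \<subseteq> elements (generated n G T)"
  unfolding generated_def elements_def Let_def by auto

lemma finite_in_chain:
  assumes chain: "\<And>i. S i \<subseteq> S (Suc i)" and un: "(\<Union>i. elements (generated n G (S i))) = elements G"
    and F: "finite F" "F \<subseteq> elements G"
  shows "\<exists>j. F \<subseteq> elements (generated n G (S j))"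
  using F
proof (induction F rule: finite_induct)
  case (insert x F)
  then obtain j k where "F \<subseteq> elements (generated n G (S j))" "x \<in> elements (generated n G (S k))"
    using un by blast
  moreover have "S i \<subseteq> S (max j k)" if "i \<le> max j k" for i
    using lift_Suc_mono_le[of S] chain that by blast
  ultimately have "insert x F \<subseteq> elements (generated n G (S (max j k)))"
    using generated_mono[of "S j" "S (max j k)"] generated_mono[of "S k" "S (max j k)"] by fastforce
  thus ?case by blast
qed simp

locale labelled_gon = weak_gon n G + labelled_polygon "elements G" "adjacent G" "gdist G" n lab
  for n and G :: "('p, 'l) geometry" and lab
begin

text \<open>For each residue a vertex and two of its upper neighbours are put into one finite sub
  polygon \<open>H\<close> of the chain. There the labelling is still surjective and upper
  neighbours are still several, which \<open>finite_not_all_several\<close> refutes.\<close>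

lemma chained_not_all_several:
  assumes "locally_finitely_chained n G"
  shows "\<exists>i x. L i x \<and> \<not> several (up i x)"
proof (rule ccontr)
  assume "\<not> ?thesis"
  hence all: "several (up i x)" if "L i x" for i x using that by blast
  obtain S where S0: "\<forall>i. finite (S i) \<and> S i \<subseteq> pts G \<and> S i \<subseteq> S (Suc i)"
    "\<forall>i. sub_gon n (generated n G (S i)) G \<and>
      finite (pts (generated n G (S i))) \<and> finite (lns (generated n G (S i)))"
    and S1: "(\<Union>i. pts (generated n G (S i))) = pts G" "(\<Union>i. lns (generated n G (S i))) = lns G"
    using assms unfolding locally_finitely_chained_def by (elim exE conjE) (rule that)
  have un: "(\<Union>i. elements (generated n G (S i))) = elements G"
  proof (rule set_eqI)
    fix x show "x \<in> (\<Union>i. elements (generated n G (S i))) \<longleftrightarrow> x \<in> elements G"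
      by (cases x) (simp_all add: S1[symmetric])
  qed
  obtain x where x: "\<And>i. L i (x i)" using L_ex by metis
  obtain y z where yz: "\<And>i. y i \<in> up i (x i)" "\<And>i. z i \<in> up i (x i)" "\<And>i. y i \<noteq> z i"
    using all[OF x] unfolding several_def by metis
  let ?I = "{0..<2 * int n}"
  define F where "F = x ` ?I \<union> y ` ?I \<union> z ` ?I"
  have "y i \<in> elements G" "z i \<in> elements G" for i
    using yz(1,2)[of i] L_V unfolding up_def by blast+
  hence "finite F" "F \<subseteq> elements G" using L_V[OF x] unfolding F_def by auto
  then obtain j where j: "F \<subseteq> elements (generated n G (S j))"
    using finite_in_chain[of S n G F] S0(1) un by blast
  define H where "H = generated n G (S j)"
  have sub: "subgeometry H G" and wH: "weak_generalized_gon n H"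
    using S0(2) by (auto simp: H_def sub_gon_def)
  have FH: "x i \<in> elements H" "y i \<in> elements H" "z i \<in> elements H" if "i \<in> ?I" for i
    using j that by (auto simp: F_def H_def)
  interpret H: weak_gon n H by standard (rule wH)
  have mI: "i mod (2 * int n) \<in> ?I" "2 * int n dvd i mod (2 * int n) - i" for i
    using n3 by (auto simp: mod_eq_dvd_iff[symmetric])
  interpret H: labelled_polygon "elements H" "adjacent H" "gdist H" n lab
  proof
    show "2 * int n dvd lab y - lab x - 1 \<or> 2 * int n dvd lab y - lab x + 1" if "adjacent H x y" for x y
      using lab_step adjacent_subgeometry[OF sub] that by blast
    show "\<exists>x\<in>elements H. 2 * int n dvd lab x - i" for i
    proof -
      have "L i (x (i mod (2 * int n)))" using x L_cong[OF mI(2)] by blast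
      thus ?thesis using FH(1) mI(1) by (auto simp: L_def)
    qed
  qed
  have HL: "H.L i v \<longleftrightarrow> L i v" if "v \<in> elements H" for i v
    using that elements_subgeometry[OF sub] by (auto simp: H.L_def L_def)
  have "finite (elements H)" using S0(2) by (simp add: elements_def H_def)
  then obtain i v where v: "H.L i v" "\<not> several (H.up i v)"
    using H.finite_not_all_several by blast
  \<comment> \<open>Vertices were chosen for the residues from \<open>0\<close> to
    \<open>2 * n - 1\<close> only, so \<open>i\<close> is replaced by its representative.\<close>
  define r where "r = i mod (2 * int n)"
  have r: "r \<in> ?I" "2 * int n dvd r - i" using mI by (auto simp: r_def)
  have xr: "H.L i (x r)" using HL[OF FH(1)[OF r(1)]] x[of r] L_cong[OF r(2)] by blast
  have up: "w \<in> H.up i (x r)" if "w \<in> up r (x r)" "w \<in> elements H" for w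
    using that HL[OF that(2)] up_cong[OF r(2), of "x r"] adjacent_subgeometry[OF sub] FH(1)[OF r(1)]
    by (auto simp: up_def H.up_def)
  have "several (H.up i (x r))"
    using up[OF yz(1) FH(2)[OF r(1)]] up[OF yz(2) FH(3)[OF r(1)]] yz(3)[of r] unfolding several_def by blast
  thus False using H.several_up[OF v(1) xr] v(2) by blast
qed

end

section \<open>Pulling labels back along the epimorphism\<close>

locale gon_epimorphism =
  dom: weak_gon n \<Gamma> + cod: weak_gon n \<Delta>
  for n and \<Gamma> :: "('p, 'l) geometry" and \<Delta> :: "('q, 'm) geometry" +
  fixes f :: "'p \<Rightarrow> 'q" and g :: "'l \<Rightarrow> 'm"
  assumes thick: "thick \<Gamma>" and chained: "locally_finitely_chained n \<Gamma>"
    and epi: "epimorphism \<Gamma> \<Delta> f g"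
begin

abbreviation \<gamma> :: "'p + 'l \<Rightarrow> 'q + 'm" where
  "\<gamma> \<equiv> map_sum f g"

lemma \<gamma>_adjacent: "adjacent \<Gamma> x y \<Longrightarrow> adjacent \<Delta> (\<gamma> x) (\<gamma> y)"
  using epi by (auto simp: adjacent_def epimorphism_def morphism_def)

lemma \<gamma>_in: "x \<in> elements \<Gamma> \<Longrightarrow> \<gamma> x \<in> elements \<Delta>"
  using epi by (auto simp: elements_def epimorphism_def morphism_def)

lemma \<gamma>_surj: "v \<in> elements \<Delta> \<Longrightarrow> \<exists>x \<in> elements \<Gamma>. \<gamma> x = v"
proof (cases v)
  case (Inl q)
  assume "v \<in> elements \<Delta>"
  hence "q \<in> f ` pts \<Gamma>" using epi Inl by (simp add: epimorphism_def)
  then obtain p where "p \<in> pts \<Gamma>" "f p = q" by blast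
  thus ?thesis using Inl by (intro bexI[of _ "Inl p"]) auto
next
  case (Inr m)
  assume "v \<in> elements \<Delta>"
  hence "m \<in> g ` lns \<Gamma>" using epi Inr by (simp add: epimorphism_def)
  then obtain l where "l \<in> lns \<Gamma>" "g l = m" by blast
  thus ?thesis using Inr by (intro bexI[of _ "Inr l"]) auto
qed

lemma \<gamma>_dist:
  assumes "x \<in> elements \<Gamma>" "y \<in> elements \<Gamma>"
  shows "gdist \<Delta> (\<gamma> x) (\<gamma> y) \<le> gdist \<Gamma> x y"
proof -
  have "(adjacent \<Delta> ^^ k) (\<gamma> x) (\<gamma> y)" if "(adjacent \<Gamma> ^^ k) x y" for k y
    using that
  proof (induction k arbitrary: y)
    case (Suc k)
    then obtain z where "(adjacent \<Gamma> ^^ k) x z" "adjacent \<Gamma> z y" by (auto elim: relpowp_Suc_E)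
    thus ?case using Suc.IH \<gamma>_adjacent by (blast intro: relpowp_Suc_I)
  qed simp
  thus ?thesis using dom.gdist_walk[OF assms] gdist_le by blast
qed

lemma three_neighbours:
  assumes "x \<in> elements \<Gamma>"
  shows "\<exists>a b c. adjacent \<Gamma> x a \<and> adjacent \<Gamma> x b \<and> adjacent \<Gamma> x c \<and> distinct [a, b, c]"
proof (cases x)
  case (Inl p)
  hence "3 \<le> ecard (lines_through \<Gamma> p)" using thick assms by (simp add: thick_def)
  then obtain a b c where abc: "a \<in> lines_through \<Gamma> p" "b \<in> lines_through \<Gamma> p"
    "c \<in> lines_through \<Gamma> p" "distinct [a, b, c]"
    unfolding ecard_ge_3 by blast
  thus ?thesis
    by (intro exI[of _ "Inr a"] exI[of _ "Inr b"] exI[of _ "Inr c"]) (auto simp: Inl lines_through_def)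
next
  case (Inr l)
  hence "3 \<le> ecard (points_on \<Gamma> l)" using thick assms by (simp add: thick_def)
  then obtain a b c where abc: "a \<in> points_on \<Gamma> l" "b \<in> points_on \<Gamma> l"
    "c \<in> points_on \<Gamma> l" "distinct [a, b, c]"
    unfolding ecard_ge_3 by blast
  thus ?thesis
    by (intro exI[of _ "Inl a"] exI[of _ "Inl b"] exI[of _ "Inl c"]) (auto simp: Inr points_on_def)
qed

text \<open>\<Delta> is labelled by the retraction and \<Gamma> through \<open>\<gamma>\<close>;
  \<open>e\<close> is the vertex of \<open>singleton_label\<close> and \<open>u\<close> its image.
  That \<open>u\<close> is alone with its label serves to locate it near the flag. The last clause
  lifts a neighbour of \<open>\<gamma> x\<close> only up to its label, which is a true lift once the
  retraction is injective.\<close>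

lemma singleton_fibre:
  assumes ab: "adjacent \<Delta> a b"
  obtains u e where "u \<in> elements \<Delta>" "e \<in> elements \<Gamma>" "\<And>x. x \<in> elements \<Gamma> \<Longrightarrow> \<gamma> x = u \<longleftrightarrow> x = e"
    "\<And>x. x \<in> elements \<Gamma> \<Longrightarrow> gdist \<Gamma> e x = gdist \<Delta> u (\<gamma> x)"
    "\<And>v. v \<in> elements \<Delta> \<Longrightarrow> 2 * int n dvd cod.retraction a b v - cod.retraction a b u \<Longrightarrow> v = u"
    "\<And>x v. x \<in> elements \<Gamma> \<Longrightarrow> adjacent \<Delta> (\<gamma> x) v \<Longrightarrow>
      \<exists>y. adjacent \<Gamma> x y \<and> 2 * int n dvd cod.retraction a b (\<gamma> y) - cod.retraction a b v"
proof -
  let ?\<rho> = "cod.retraction a b"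
  interpret D: labelled_polygon "elements \<Delta>" "adjacent \<Delta>" "gdist \<Delta>" n ?\<rho>
    by standard (use cod.retraction_step[OF ab] cod.retraction_surj[OF ab] in blast)+
  interpret G: labelled_polygon "elements \<Gamma>" "adjacent \<Gamma>" "gdist \<Gamma>" n "\<lambda>x. ?\<rho> (\<gamma> x)"
  proof
    show "2 * int n dvd ?\<rho> (\<gamma> y) - ?\<rho> (\<gamma> x) - 1 \<or> 2 * int n dvd ?\<rho> (\<gamma> y) - ?\<rho> (\<gamma> x) + 1"
      if "adjacent \<Gamma> x y" for x y using D.lab_step \<gamma>_adjacent[OF that] by blast
    show "\<exists>x\<in>elements \<Gamma>. 2 * int n dvd ?\<rho> (\<gamma> x) - i" for i using D.lab_surj \<gamma>_surj by metis
  qed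
  interpret GL: labelled_gon n \<Gamma> "\<lambda>x. ?\<rho> (\<gamma> x)" ..
  have L: "D.L i (\<gamma> x)" if "G.L i x" for i x
    using that \<gamma>_in by (auto simp: G.L_def D.L_def)
  obtain i x where "G.L i x" "\<not> several (G.up i x)"
    using GL.chained_not_all_several[OF chained] by blast
  from G.singleton_label[OF three_neighbours this]
  obtain c e where e: "\<And>x. G.L c x \<longleftrightarrow> x = e" by blast
  have e': "G.L c e" "e \<in> elements \<Gamma>" using e G.L_V by blast+
  have u: "D.L c (\<gamma> e)" using L e' by blast
  have uniq: "x = e" if "x \<in> elements \<Gamma>" "2 * int n dvd ?\<rho> (\<gamma> x) - ?\<rho> (\<gamma> e)" for x
  proof -
    have "2 * int n dvd (?\<rho> (\<gamma> x) - ?\<rho> (\<gamma> e)) + (?\<rho> (\<gamma> e) - c)"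
      using that(2) e'(1) by (intro dvd_add) (auto simp: G.L_def)
    hence "G.L c x" using that(1) by (simp add: G.L_def)
    thus ?thesis using e by blast
  qed
  show thesis
  proof (rule that[of "\<gamma> e" e])
    show "\<gamma> e \<in> elements \<Delta>" "e \<in> elements \<Gamma>" using e' \<gamma>_in by blast+
    show "\<gamma> x = \<gamma> e \<longleftrightarrow> x = e" if "x \<in> elements \<Gamma>" for x using uniq[OF that] by auto
    show "v = \<gamma> e" if "v \<in> elements \<Delta>" "2 * int n dvd ?\<rho> v - ?\<rho> (\<gamma> e)" for v
      using \<gamma>_surj[OF that(1)] uniq that(2) by blast
    \<comment> \<open>The displacement of labels equals the distance in \<Gamma> and bounds that in
      \<Delta> from below, while \<open>\<gamma>\<close> does not increase distances.\<close>
    show "gdist \<Gamma> e x = gdist \<Delta> (\<gamma> e) (\<gamma> x)" if x: "x \<in> elements \<Gamma>" for x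
    proof -
      obtain t where t: "\<bar>t\<bar> \<le> int n" "G.L (c + t) x" using G.L_range[OF x] by blast
      have "int (gdist \<Gamma> e x) = \<bar>t\<bar>" using G.singleton_dist[OF e t] .
      moreover have "\<bar>t\<bar> \<le> int (gdist \<Delta> (\<gamma> e) (\<gamma> x))" using D.L_dist(1)[OF u L[OF t(2)] t(1)] .
      ultimately show ?thesis using \<gamma>_dist[OF e'(2) x] by linarith
    qed
    show "\<exists>y. adjacent \<Gamma> x y \<and> 2 * int n dvd ?\<rho> (\<gamma> y) - ?\<rho> v"
      if x: "x \<in> elements \<Gamma>" and v: "adjacent \<Delta> (\<gamma> x) v" for x v
    proof -
      have Lx: "G.L (?\<rho> (\<gamma> x)) x" using G.L_lab[OF x] .
      have "D.L (?\<rho> (\<gamma> x) + 1) v \<or> D.L (?\<rho> (\<gamma> x) - 1) v" using D.L_adj[OF L[OF Lx] v] .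
      then obtain i where i: "i = ?\<rho> (\<gamma> x) + 1 \<or> i = ?\<rho> (\<gamma> x) - 1" "D.L i v" by blast
      obtain y where y: "adjacent \<Gamma> x y" "G.L i y"
        using G.up_ne[OF Lx] G.dn_ne[OF Lx] i(1) by (auto simp: G.up_def G.dn_def)
      have "2 * int n dvd ?\<rho> (\<gamma> y) - i" "2 * int n dvd ?\<rho> v - i"
        using y(2) i(2) by (auto simp: G.L_def D.L_def)
      from dvd_diff[OF this] show ?thesis using y(1) by auto
    qed
  qed
qed

section \<open>Excluding lines of \<Delta> with three points\<close>

lemma unique_step_lift:
  assumes e: "e \<in> elements \<Gamma>" "\<And>x. x \<in> elements \<Gamma> \<Longrightarrow> gdist \<Gamma> e x = gdist \<Delta> u (\<gamma> x)"
    and x: "x \<in> elements \<Gamma>" "gdist \<Delta> u (\<gamma> x) = Suc k" "Suc k < n"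
    and y: "adjacent \<Gamma> x y" "adjacent \<Gamma> x y'" "\<gamma> y = w" "\<gamma> y' = w" "gdist \<Delta> u w = k"
  shows "y = y'"
proof -
  have "y \<in> elements \<Gamma>" "y' \<in> elements \<Gamma>" using y dom.adj_in2 by blast+
  \<comment> \<open>Distances from \<open>e\<close> are preserved, so \<open>y\<close> and
    \<open>y'\<close> are both steps from \<open>x\<close> towards \<open>e\<close>.\<close>
  thus ?thesis using dom.d_unique[OF e(1), of x k y y'] e(2) x y by simp
qed

text \<open>A point over \<open>z\<close> has three lines, each over \<open>w\<close> or
  \<open>w'\<close>. Only one of them lies over \<open>w\<close>, the step towards \<open>u\<close>,
  and only one over \<open>w'\<close>, the step towards \<open>u'\<close>.\<close>

lemma two_singleton_fibres:
  assumes deg2: "\<And>p k1 k2 k3. p \<in> pts \<Delta> \<Longrightarrow> (p, k1) \<in> inc \<Delta> \<Longrightarrow> (p, k2) \<in> inc \<Delta> \<Longrightarrow> (p, k3) \<in> inc \<Delta> \<Longrightarrow>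
      k1 = k2 \<or> k1 = k3 \<or> k2 = k3"
    and e: "e \<in> elements \<Gamma>" "\<And>x. x \<in> elements \<Gamma> \<Longrightarrow> gdist \<Gamma> e x = gdist \<Delta> u (\<gamma> x)"
    and e': "e' \<in> elements \<Gamma>" "\<And>x. x \<in> elements \<Gamma> \<Longrightarrow> gdist \<Gamma> e' x = gdist \<Delta> u' (\<gamma> x)"
    and z: "Inl z \<in> elements \<Delta>" "adjacent \<Delta> (Inl z) w" "adjacent \<Delta> (Inl z) w'" "w \<noteq> w'"
    and d: "gdist \<Delta> u (Inl z) = Suc (gdist \<Delta> u w)" "gdist \<Delta> u (Inl z) < n"
    and d': "gdist \<Delta> u' (Inl z) = Suc (gdist \<Delta> u' w')" "gdist \<Delta> u' (Inl z) < n"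
  shows False
proof -
  obtain x where x: "x \<in> elements \<Gamma>" "\<gamma> x = Inl z" using \<gamma>_surj z(1) by blast
  obtain a b c where abc: "adjacent \<Gamma> x a" "adjacent \<Gamma> x b" "adjacent \<Gamma> x c" "distinct [a, b, c]"
    using three_neighbours[OF x(1)] by blast
  have img: "\<gamma> y = w \<or> \<gamma> y = w'" if "adjacent \<Gamma> x y" for y
    using \<gamma>_adjacent[OF that] x(2) z deg2 by (fastforce simp: adjacent_def)
  have 1: "y = y'" if "adjacent \<Gamma> x y" "adjacent \<Gamma> x y'" "\<gamma> y = w" "\<gamma> y' = w" for y y'
    using unique_step_lift[OF e x(1), where w = w and y = y and y' = y'] x(2) d that by simp
  have 2: "y = y'" if "adjacent \<Gamma> x y" "adjacent \<Gamma> x y'" "\<gamma> y = w'" "\<gamma> y' = w'" for y y'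
    using unique_step_lift[OF e' x(1), where w = w' and y = y and y' = y'] x(2) d' that by simp
  show False
    using img[OF abc(1)] img[OF abc(2)] img[OF abc(3)] 1 2 abc by (metis distinct_length_2_or_more)
qed

text \<open>A branch has one label per level. Vertices on the side of \<open>p\<close> at distance
  at least two are reached through a line other than \<open>k\<close>, and those on the other side,
  except \<open>k\<close> itself, through \<open>k\<close>. A third point on that line yields, by
  \<open>branch_two\<close>, a second vertex with the same label.\<close>

lemma (in weak_gon) unique_label_near_flag:
  assumes pk: "(p, k) \<in> inc G"
    and thick_lines: "\<And>m x y. m \<in> lns G \<Longrightarrow> \<exists>q. (q, m) \<in> inc G \<and> q \<noteq> x \<and> q \<noteq> y"
    and u: "u \<in> elements G"
    and uniq: "\<And>v. v \<in> elements G \<Longrightarrow>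
      2 * int n dvd retraction (Inl p) (Inr k) v - retraction (Inl p) (Inr k) u \<Longrightarrow> v = u"
  shows "gdist G (Inl p) u \<le> 1"
proof -
  let ?p = "Inl p :: 'p + 'l" and ?k = "Inr k :: 'p + 'l"
  have adj: "adjacent G ?p ?k" "adjacent G ?k ?p" using pk by auto
  have V: "?p \<in> elements G" "?k \<in> elements G" using adj adj_in by blast+
  have deg3: "\<forall>w. \<exists>y. adjacent G (Inr m) y \<and> y \<noteq> Inl q \<and> y \<noteq> w" if m: "m \<in> lns G" for m q
  proof
    fix w :: "'p + 'l"
    \<comment> \<open>If \<open>w\<close> is a line, \<open>projl w\<close> is unspecified, but then
      \<open>Inl r\<close> differs from \<open>w\<close> anyway.\<close>
    obtain r where "(r, m) \<in> inc G" "r \<noteq> q" "r \<noteq> projl w" using thick_lines[OF m] by blast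
    thus "\<exists>y. adjacent G (Inr m) y \<and> y \<noteq> Inl q \<and> y \<noteq> w" by (intro exI[of _ "Inl r"]) auto
  qed
  show ?thesis
  proof (cases rule: branch_cases[OF adj(1) u])
    case (1 j)
    show ?thesis
    proof (cases "j \<le> 1")
      case True
      thus ?thesis using 1 by (simp add: branch_def)
    next
      case False
      then obtain i where i: "j = Suc (Suc i)" by (metis One_nat_def Suc_le_mono bot_nat_0.extremum not0_implies_Suc)
      have du: "gdist G u ?p = Suc (Suc i)" "gdist G u ?k = Suc (Suc (Suc i))"
        using 1(2) i d_sym[of u] by (auto simp: branch_def)
      obtain z where z: "adjacent G ?p z" "gdist G u z = Suc i" using d_pred[OF u V(1) du(1)] by blast
      obtain m where m: "z = Inr m" "m \<in> lns G" using z(1) adj_in2[OF z(1)] by (auto simp: adjacent_def)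
      have "u \<in> branch z ?p (Suc i)" using u du z(2) d_sym[of u] by (auto simp: branch_def)
      then obtain v where v: "v \<in> branch z ?p (Suc i)" "v \<noteq> u"
        using branch_two[OF adj_sym[OF z(1)], of u i] deg3[OF m(2)] m(1) 1(1) i by auto
      have vV: "v \<in> elements G" and dv: "gdist G v z = Suc i" "gdist G v ?p = Suc (Suc i)"
        using v(1) d_sym[of v] by (auto simp: branch_def)
      have "?k \<noteq> z" using z(2) du(2) by auto
      hence "gdist G v ?k = Suc (Suc (Suc i))"
        using d_away[OF vV dv(2) _ z(1) dv(1) adj(1)] 1(1) i by simp
      hence "v \<in> branch ?p ?k j" using vV dv(2) i d_sym[of v] by (auto simp: branch_def)
      thus ?thesis using uniq[OF vV] v(2) 1(2) by (simp add: retraction_branch0)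
    qed
  next
    case (2 j)
    show ?thesis
    proof (cases j)
      case 0
      thus ?thesis using 2 by (simp add: branch_def)
    next
      case (Suc i)
      have "k \<in> lns G" using V by simp
      then obtain v where v: "v \<in> branch ?k ?p j" "v \<noteq> u"
        using branch_two[OF adj(2), of u i] deg3 2 Suc by auto
      hence "v \<in> elements G" by (simp add: branch_def)
      thus ?thesis using uniq[of v] v 2(2) by (simp add: retraction_branch1)
    qed
  qed
qed

text \<open>As \<open>n\<close> is even, \<open>p\<close> has an opposite point \<open>q\<close>.
  Vertices \<open>u\<close> and \<open>u'\<close> as in \<open>singleton_fibre\<close> lie within
  one step of \<open>p\<close> and \<open>q\<close>, so they are at distance at least
  \<open>n - 2\<close>, and a point inside a shortest path between them contradicts
  \<open>two_singleton_fibres\<close>. It is taken next to a line among \<open>u\<close>,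
  \<open>u'\<close>, or two steps from \<open>u\<close> if both are points.\<close>

lemma not_order_ge_2:
  assumes n: "even n" "4 \<le> n"
    and deg2: "\<And>p k1 k2 k3. p \<in> pts \<Delta> \<Longrightarrow> (p, k1) \<in> inc \<Delta> \<Longrightarrow> (p, k2) \<in> inc \<Delta> \<Longrightarrow> (p, k3) \<in> inc \<Delta> \<Longrightarrow>
      k1 = k2 \<or> k1 = k3 \<or> k2 = k3"
    and thick_lines: "\<And>m x y. m \<in> lns \<Delta> \<Longrightarrow> \<exists>q. (q, m) \<in> inc \<Delta> \<and> q \<noteq> x \<and> q \<noteq> y"
    and p: "p \<in> pts \<Delta>"
  shows False
proof -
  let ?V = "elements \<Delta>" and ?d = "gdist \<Delta>"
  have flag: "\<exists>k. (q, k) \<in> inc \<Delta>" if "q \<in> pts \<Delta>" for q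
    using cod.deg_ge_2[of "Inl q"] that by (auto simp: adjacent_def)
  have near: "\<exists>u e. u \<in> ?V \<and> e \<in> elements \<Gamma> \<and> (\<forall>x \<in> elements \<Gamma>. gdist \<Gamma> e x = ?d u (\<gamma> x)) \<and> ?d (Inl q) u \<le> 1"
    if q: "q \<in> pts \<Delta>" for q
  proof -
    obtain k where k: "(q, k) \<in> inc \<Delta>" using flag[OF q] by blast
    hence "adjacent \<Delta> (Inl q) (Inr k)" by simp
    from singleton_fibre[OF this] obtain u e where *: "u \<in> ?V" "e \<in> elements \<Gamma>"
      "\<And>x. x \<in> elements \<Gamma> \<Longrightarrow> gdist \<Gamma> e x = ?d u (\<gamma> x)"
      "\<And>v. v \<in> ?V \<Longrightarrow> 2 * int n dvd cod.retraction (Inl q) (Inr k) v - cod.retraction (Inl q) (Inr k) u \<Longrightarrow> v = u"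
      by metis
    thus ?thesis using cod.unique_label_near_flag[OF k thick_lines *(1) *(4)] by blast
  qed
  obtain k where k: "(p, k) \<in> inc \<Delta>" using flag[OF p] by blast
  have "cod.branch (Inr k) (Inl p) (n - 1) \<noteq> {}" using cod.branch_ne k n by simp
  then obtain q' where q': "q' \<in> ?V" "?d (Inl p) q' = n" using n by (auto simp: cod.branch_def)
  have "isl q'" using cod.gdist_parity[OF _ q'(1), of "Inl p"] q'(2) p n by simp
  then obtain q where q: "q' = Inl q" by (cases q') auto
  obtain u e where u: "u \<in> ?V" "e \<in> elements \<Gamma>" "\<And>x. x \<in> elements \<Gamma> \<Longrightarrow> gdist \<Gamma> e x = ?d u (\<gamma> x)"
    "?d (Inl p) u \<le> 1" using near[OF p] by blast
  obtain u' e' where u': "u' \<in> ?V" "e' \<in> elements \<Gamma>" "\<And>x. x \<in> elements \<Gamma> \<Longrightarrow> gdist \<Gamma> e' x = ?d u' (\<gamma> x)"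
    "?d (Inl q) u' \<le> 1" using near[of q] q' q by auto
  have dn: "n \<le> ?d u u' + 2"
    using cod.gdist_triangle[of "Inl p" u u'] cod.gdist_triangle[of "Inl p" u' "Inl q"] p q q' u u'
      cod.d_sym[of u' "Inl q"] by simp
  have no: False if "Inl z \<in> ?V" "adjacent \<Delta> (Inl z) w" "adjacent \<Delta> (Inl z) w'" "w \<noteq> w'"
      "?d u (Inl z) = Suc (?d u w)" "?d u (Inl z) < n" "?d u' (Inl z) = Suc (?d u' w')" "?d u' (Inl z) < n"
    for z w w'
    by (rule two_singleton_fibres[of e u e' u' z w w']) (fact deg2 u u' that)+
  \<comment> \<open>\<open>nz\<close> will be \<open>no\<close> or its mirror image, so that either
    of \<open>u\<close> and \<open>u'\<close> can be the line \<open>a\<close>.\<close>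
  have no_line: False if a: "a \<in> ?V" "b \<in> ?V" "\<not> isl a" "n \<le> ?d a b + 2" and
    nz: "\<And>z w w'. Inl z \<in> ?V \<Longrightarrow> adjacent \<Delta> (Inl z) w \<Longrightarrow> adjacent \<Delta> (Inl z) w' \<Longrightarrow> w \<noteq> w' \<Longrightarrow>
      ?d a (Inl z) = Suc (?d a w) \<Longrightarrow> ?d a (Inl z) < n \<Longrightarrow>
      ?d b (Inl z) = Suc (?d b w') \<Longrightarrow> ?d b (Inl z) < n \<Longrightarrow> False" for a b
  proof -
    have "2 \<le> ?d b a" "?d b a \<le> n" using a n cod.d_sym[of b a] cod.d_le[of b a] by auto
    then obtain i where i: "?d b a = Suc (Suc i)" "Suc (Suc i) \<le> n" by (metis add_2_eq_Suc le_Suc_ex)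
    obtain z where z: "adjacent \<Delta> a z" "?d b z = Suc i" using cod.d_pred[OF a(2,1) i(1)] by blast
    have zV: "z \<in> ?V" using z cod.adj_in2 by blast
    obtain w' where w': "adjacent \<Delta> z w'" "?d b w' = i" using cod.d_pred[OF a(2) zV z(2)] by blast
    have "isl z" using adjacent_isl[OF z(1)] a(3) by simp
    then obtain y where y: "z = Inl y" by (cases z) auto
    have "?d a z = 1" using cod.d_eq_1[OF a(1) zV] z by simp
    moreover have "w' \<noteq> a" using w'(2) i(1) by auto
    ultimately show False
      using nz[of y a w'] zV z w' y i cod.adj_sym[OF z(1)] cod.d_self[OF a(1)] n by auto
  qed
  show False
  proof (cases "isl u \<and> isl u'")
    case True
    \<comment> \<open>Both distances are even and at most one, so \<open>u\<close> and
      \<open>u'\<close> are the opposite points themselves.\<close>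
    have "?d (Inl p) u = 0" "?d (Inl q) u' = 0"
      using cod.gdist_parity[of "Inl p" u] cod.gdist_parity[of "Inl q" u'] True p q q' u u' by auto
    hence uu: "u = Inl p" "u' = Inl q" using cod.d_eq_0 p q q' u u' by auto
    have "?d u' u = Suc (n - 1)" using uu q' q cod.d_sym[of u u'] n by simp
    then obtain m where m: "adjacent \<Delta> u m" "?d u' m = n - 1" using cod.d_pred u' u by blast
    have mV: "m \<in> ?V" using m cod.adj_in2 by blast
    have "?d u' m = Suc (n - 2)" using m n by simp
    then obtain z where z: "adjacent \<Delta> m z" "?d u' z = n - 2" using cod.d_pred u' mV by blast
    have zV: "z \<in> ?V" using z cod.adj_in2 by blast
    have "?d u' z = Suc (n - 3)" using z n by simp
    then obtain w' where w': "adjacent \<Delta> z w'" "?d u' w' = n - 3" using cod.d_pred u' zV by blast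
    have "isl z" using adjacent_isl[OF z(1)] adjacent_isl[OF m(1)] True by simp
    then obtain y where y: "z = Inl y" by (cases z) auto
    have "?d u m = 1" using cod.d_eq_1[OF u(1) mV] m by simp
    moreover have "z \<noteq> u" using z(2) \<open>?d u' u = Suc (n - 1)\<close> n by auto
    ultimately have "?d u z = 2" using cod.d_step[OF u(1) z(1)] cod.d_eq_0[OF u(1) zV] by auto
    moreover have "m \<noteq> w'" using m(2) w'(2) n by auto
    moreover have "n - 2 = Suc (n - 3)" "n - 2 < n" using n by simp_all
    ultimately show False
      using no[of y m w'] zV z m w' y cod.adj_sym n \<open>?d u m = 1\<close> by auto
  next
    case False
    show False
    proof (cases "isl u")
      case True
      hence "\<not> isl u'" using False by blast
      moreover have "n \<le> ?d u' u + 2" using dn cod.d_sym[of u u'] by simp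
      ultimately show False using no_line[OF u'(1) u(1)] no by blast
    next
      case False
      show False using no_line[OF u(1) u'(1) False dn] no by blast
    qed
  qed
qed

end

section \<open>Recognizing the two types\<close>

text \<open>The hypotheses are self-dual up to exchanging \<open>p\<close> and \<open>l\<close>, so that type (b) is obtained from the
  dual geometries. The lines and points of the ordinary polygon occur in the cyclic order
  \<open>l 0, p 0, l 1, p 1, \<dots>\<close>.\<close>

lemma fibre_eqI: "(\<And>x. x \<in> X \<Longrightarrow> h x = y \<longleftrightarrow> P x) \<Longrightarrow> fibre X h y = {x \<in> X. P x}"
  by (auto simp: fibre_def)

locale lifted_gon =
  fixes n :: nat and G :: "('p, 'l) geometry" and D :: "('q, 'm) geometry"
    and f :: "'p \<Rightarrow> 'q" and g :: "'l \<Rightarrow> 'm" and p :: "nat \<Rightarrow> 'q" and l :: "nat \<Rightarrow> 'm" and L :: 'l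
  assumes n: "3 \<le> n"
    and inc_G: "(x, m) \<in> inc G \<Longrightarrow> x \<in> pts G \<and> m \<in> lns G"
    and pts_D: "pts D = p ` {..<n}" "inj_on p {..<n}"
    and lns_D: "lns D = l ` {..<n}" "inj_on l {..<n}"
    and inc_D: "i < n \<Longrightarrow> j < n \<Longrightarrow> (p i, l j) \<in> inc D \<longleftrightarrow> j = i \<or> j = Suc i mod n"
    and f: "x \<in> pts G \<Longrightarrow> f x \<in> pts D" and g: "m \<in> lns G \<Longrightarrow> g m \<in> lns D"
    and fg: "(x, m) \<in> inc G \<Longrightarrow> (f x, g m) \<in> inc D"
    and lift_line: "x \<in> pts G \<Longrightarrow> k \<in> lns D \<Longrightarrow> (f x, k) \<in> inc D \<Longrightarrow> \<exists>m. (x, m) \<in> inc G \<and> g m = k"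
    and lift_point: "m \<in> lns G \<Longrightarrow> q \<in> pts D \<Longrightarrow> (q, g m) \<in> inc D \<Longrightarrow> \<exists>x. (x, m) \<in> inc G \<and> f x = q"
    and L: "L \<in> lns G" "m \<in> lns G \<Longrightarrow> g m = l 0 \<longleftrightarrow> m = L"
begin

section \<open>Adjacency in \<Delta> and its lift to \<Gamma>\<close>

lemma p_eq: "i < n \<Longrightarrow> j < n \<Longrightarrow> p i = p j \<longleftrightarrow> i = j"
  using pts_D(2) by (auto simp: inj_on_def)

lemma l_eq: "i < n \<Longrightarrow> j < n \<Longrightarrow> l i = l j \<longleftrightarrow> i = j"
  using lns_D(2) by (auto simp: inj_on_def)

lemma points_on_G: "points_on G m = {x. (x, m) \<in> inc G}"
  using inc_G by (auto simp: points_on_def)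

lemma collinear_G: "collinear G x y \<longleftrightarrow> (\<exists>m. (x, m) \<in> inc G \<and> (y, m) \<in> inc G)"
  using inc_G by (auto simp: collinear_def points_on_G)

lemma collinear_D: "i < n \<Longrightarrow> collinear D (p i) (p (Suc i mod n))"
  using inc_D[of i "Suc i mod n"] inc_D[of "Suc i mod n" "Suc i mod n"] n
  unfolding collinear_def points_on_def pts_D(1) lns_D(1)
  by (intro bexI[of _ "l (Suc i mod n)"]) auto

lemma join_D:
  assumes i: "i < n"
  shows "join D (p i) (p (Suc i mod n)) = l (Suc i mod n)"
    and "join D (p (Suc i mod n)) (p i) = l (Suc i mod n)"
proof -
  have *: "m \<in> lns D \<and> p i \<in> points_on D m \<and> p (Suc i mod n) \<in> points_on D m \<longleftrightarrow> m = l (Suc i mod n)" for m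
  proof -
    have "Suc i mod n < n" "Suc i mod n \<noteq> i" "Suc (Suc i mod n) mod n \<noteq> i"
      using i n by (auto simp: mod_Suc)
    thus ?thesis using i inc_D unfolding points_on_def pts_D(1) lns_D(1) by auto
  qed
  show "join D (p i) (p (Suc i mod n)) = l (Suc i mod n)" unfolding join_def * by simp
  show "join D (p (Suc i mod n)) (p i) = l (Suc i mod n)"
    unfolding join_def using * by (simp add: conj_commute conj_left_commute)
qed

lemma point_cases: assumes "x \<in> pts G" obtains i where "i < n" "f x = p i"
  using f[OF assms] pts_D by auto

lemma line_cases: assumes "m \<in> lns G" obtains i where "i < n" "g m = l i"
  using g[OF assms] lns_D by auto

lemma on_line: "x \<in> pts G \<Longrightarrow> f x = p i \<Longrightarrow> i < n \<Longrightarrow> \<exists>m. (x, m) \<in> inc G \<and> g m = l i"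
  "x \<in> pts G \<Longrightarrow> f x = p i \<Longrightarrow> i < n \<Longrightarrow> \<exists>m. (x, m) \<in> inc G \<and> g m = l (Suc i mod n)"
  using lift_line inc_D n lns_D by auto

lemma has_point: "m \<in> lns G \<Longrightarrow> g m = l i \<Longrightarrow> i < n \<Longrightarrow> \<exists>x. (x, m) \<in> inc G \<and> f x = p i"
  "m \<in> lns G \<Longrightarrow> g m = l (Suc i mod n) \<Longrightarrow> i < n \<Longrightarrow> \<exists>x. (x, m) \<in> inc G \<and> f x = p i"
  using lift_point inc_D n pts_D by auto

lemma image_line: "(x, m) \<in> inc G \<Longrightarrow> f x = p i \<Longrightarrow> i < n \<Longrightarrow> g m = l i \<or> g m = l (Suc i mod n)"
  using fg inc_D line_cases inc_G by metis

lemma image_point: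
  assumes "(x, m) \<in> inc G" "g m = l (Suc i mod n)" "i < n"
  shows "f x = p i \<or> f x = p (Suc i mod n)"
proof -
  obtain j where j: "j < n" "f x = p j" using point_cases inc_G assms by metis
  hence "Suc i mod n = j \<or> Suc i mod n = Suc j mod n" using fg[OF assms(1)] inc_D[of j "Suc i mod n"] assms n by auto
  thus ?thesis using j assms(3) by (auto simp: mod_Suc split: if_splits)
qed

text \<open>A line through a point over \<open>p i\<close> lies over one of the two lines at
  \<open>p i\<close>; excluding one leaves the other.\<close>

lemma line_up:
  assumes "m \<in> lns G" "i < n"
  shows "g m \<noteq> l i \<and> (\<exists>y. (y, m) \<in> inc G \<and> f y = p i) \<longleftrightarrow> g m = l (Suc i mod n)"
proof -
  have "Suc i mod n < n" "Suc i mod n \<noteq> i" using assms n by (auto simp: mod_Suc)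
  hence "l i \<noteq> l (Suc i mod n)" using l_eq assms by auto
  thus ?thesis using image_line has_point(2) assms by metis
qed

lemma line_down:
  assumes "m \<in> lns G" "i < n"
  shows "g m \<noteq> l (Suc i mod n) \<and> (\<exists>y. (y, m) \<in> inc G \<and> f y = p i) \<longleftrightarrow> g m = l i"
proof -
  have "Suc i mod n < n" "Suc i mod n \<noteq> i" using assms n by (auto simp: mod_Suc)
  hence "l i \<noteq> l (Suc i mod n)" using l_eq assms by auto
  thus ?thesis using image_line has_point(1) assms by metis
qed

text \<open>\<open>j\<close> and \<open>k\<close> come before and after \<open>i\<close> around the
  polygon. Collinear points have images on a common line, so no other images occur; conversely the
  lifting hypotheses produce a joining line and a point over \<open>p i\<close> on it.\<close>

lemma collinear_fibre:
  assumes x: "x \<in> pts G" and i: "i < n" "k = Suc i mod n" and j: "j < n" "i = Suc j mod n"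
  shows "(\<exists>y. f y = p i \<and> (\<exists>m. (x, m) \<in> inc G \<and> (y, m) \<in> inc G)) \<longleftrightarrow>
    f x = p j \<or> f x = p i \<or> f x = p k"
proof
  assume "\<exists>y. f y = p i \<and> (\<exists>m. (x, m) \<in> inc G \<and> (y, m) \<in> inc G)"
  then obtain y m where ym: "f y = p i" "(x, m) \<in> inc G" "(y, m) \<in> inc G" by blast
  hence "g m = l i \<or> g m = l k" using image_line[OF ym(3,1) i(1)] i by simp
  thus "f x = p j \<or> f x = p i \<or> f x = p k"
    using image_point[OF ym(2), of i] image_point[OF ym(2), of j] i j by auto
next
  assume "f x = p j \<or> f x = p i \<or> f x = p k"
  then consider "f x = p j" | "f x = p i" | "f x = p k" by blast
  thus "\<exists>y. f y = p i \<and> (\<exists>m. (x, m) \<in> inc G \<and> (y, m) \<in> inc G)"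
  proof cases
    case 1
    then obtain m where m: "(x, m) \<in> inc G" "g m = l i" using on_line(2)[OF x _ j(1)] j by auto
    thus ?thesis using has_point(1)[OF _ m(2) i(1)] inc_G by metis
  next
    case 2
    thus ?thesis using on_line(1)[OF x _ i(1)] by blast
  next
    case 3
    have "k < n" using i n by simp
    then obtain m where m: "(x, m) \<in> inc G" "g m = l k" using on_line(1)[OF x 3] by auto
    thus ?thesis using has_point(2)[OF _ _ i(1), of m] inc_G i by metis
  qed
qed

lemma on_L:
  assumes "x \<in> pts G"
  shows "(x, L) \<in> inc G \<longleftrightarrow> f x = p (n - 1) \<or> f x = p 0"
proof -
  have "n - 1 < n" "Suc (n - 1) mod n = 0" "0 < n" using n by auto
  thus ?thesis
    using image_point[of x L "n - 1"] on_line(1)[OF assms, of 0] on_line(2)[OF assms, of "n - 1"] L inc_G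
    by metis
qed

lemma fibre_ne: "fibre (pts G) f (p 0) \<noteq> {}" "fibre (pts G) f (p (n - 1)) \<noteq> {}"
  using has_point(1)[of L 0] has_point(2)[of L "n - 1"] L n inc_G by (fastforce simp: fibre_def)+

lemma L_iff: "m \<in> lns G \<Longrightarrow> m = L \<longleftrightarrow> g m = l 0"
  using L by blast

lemma inc_pts: "(x, m) \<in> inc G \<Longrightarrow> x \<in> pts G"
  using inc_G by blast

text \<open>The points \<open>a\<close>, \<open>b\<close>, \<open>c\<close>, \<open>d\<close> are
  \<open>p 3\<close>, \<open>p 0\<close>, \<open>p 1\<close>, \<open>p 2\<close>, so that
  \<open>l 0\<close> joins \<open>a\<close> and \<open>b\<close>.\<close>

lemma type_a4:
  assumes n4: "n = 4"
  shows "type_a4 G D f g"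
proof -
  have lt: "0 < n" "1 < n" "2 < n" "3 < n" using n4 by auto
  have m: "Suc 0 mod n = 1" "Suc 1 mod n = 2" "Suc 2 mod n = 3" "Suc 3 mod n = 0" "n - 1 = 3"
    using n4 by auto
  note col = collinear_D[OF lt(1)] collinear_D[OF lt(2)] collinear_D[OF lt(3)] collinear_D[OF lt(4)]
  note col = col[unfolded m]
  note jn = join_D[OF lt(1)] join_D[OF lt(2)] join_D[OF lt(3)] join_D[OF lt(4)]
  note jn = jn[unfolded m]
  have pd: "pts D = {p 3, p 0, p 1, p 2}"
    unfolding pts_D n4 by (auto simp: lessThan_Suc numeral_eq_Suc)
  have ne: "p 0 \<noteq> p 1" "p 0 \<noteq> p 2" "p 0 \<noteq> p 3" "p 1 \<noteq> p 2" "p 1 \<noteq> p 3" "p 2 \<noteq> p 3"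
    using p_eq lt by auto
  note ne = ne ne[symmetric]
  have nl: "l 1 \<noteq> l 3" using l_eq lt by auto
  have cf: "(\<exists>y \<in> fibre (pts G) f (p i). collinear G x y) \<longleftrightarrow> f x = p j \<or> f x = p i \<or> f x = p k"
    if "x \<in> pts G" "i < n" "k = Suc i mod n" "j < n" "i = Suc j mod n" for x i j k
    using collinear_fibre[OF that] inc_pts by (fastforce simp: fibre_def collinear_G)
  have lf: "(\<exists>y \<in> fibre (pts G) f q. y \<in> points_on G m) \<longleftrightarrow> (\<exists>y. (y, m) \<in> inc G \<and> f y = q)" for m q
    using inc_pts by (auto simp: fibre_def points_on_G)
  have onL: "x \<in> points_on G L \<longleftrightarrow> x \<in> pts G \<and> (f x = p 3 \<or> f x = p 0)" for x
    using on_L[of x] inc_pts m by (auto simp: points_on_G)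
  have dist: "distinct [p 3, p 0, p 1, p 2]" using ne by auto
  show ?thesis
    unfolding type_a4_def
  proof (intro exI[of _ "p 3"] exI[of _ "p 0"] exI[of _ "p 1"] exI[of _ "p 2"] conjI pd dist col,
      unfold Let_def jn, intro bexI[OF _ L(1)] conjI)
    show "fibre (pts G) f (p 3) \<union> fibre (pts G) f (p 0) = points_on G L"
      using onL by (auto simp: fibre_def)
    show "fibre (pts G) f (p 3) \<inter> fibre (pts G) f (p 0) = {}" using ne by (auto simp: fibre_def)
    show "fibre (pts G) f (p 3) \<noteq> {}" "fibre (pts G) f (p 0) \<noteq> {}" using fibre_ne m by auto
    show "fibre (pts G) f (p 1) = {x \<in> pts G. x \<notin> points_on G L \<and>
      (\<exists>y\<in>fibre (pts G) f (p 0). collinear G x y)}"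
    proof (rule fibre_eqI)
      fix x assume x: "x \<in> pts G"
      show "f x = p 1 \<longleftrightarrow> x \<notin> points_on G L \<and> (\<exists>y\<in>fibre (pts G) f (p 0). collinear G x y)"
        unfolding onL cf[OF x lt(1) m(1)[symmetric] lt(4) m(4)[symmetric]]
        using ne x by metis
    qed
    show "fibre (pts G) f (p 2) = {x \<in> pts G. x \<notin> points_on G L \<and>
      (\<exists>y\<in>fibre (pts G) f (p 3). collinear G x y)}"
    proof (rule fibre_eqI)
      fix x assume x: "x \<in> pts G"
      show "f x = p 2 \<longleftrightarrow> x \<notin> points_on G L \<and> (\<exists>y\<in>fibre (pts G) f (p 3). collinear G x y)"
        unfolding onL cf[OF x lt(4) m(4)[symmetric] lt(3) m(3)[symmetric]]
        using ne x by metis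
    qed
    show "fibre (lns G) g (l 0) = {L}" using L by (auto simp: fibre_def)
    show "fibre (lns G) g (l 1) = {m \<in> lns G. m \<noteq> L \<and> (\<exists>y\<in>fibre (pts G) f (p 0). y \<in> points_on G m)}"
      by (rule fibre_eqI) (use line_up[OF _ lt(1), unfolded m] L_iff lf in simp)
    show "fibre (lns G) g (l 3) = {m \<in> lns G. m \<noteq> L \<and> (\<exists>y\<in>fibre (pts G) f (p 3). y \<in> points_on G m)}"
      by (rule fibre_eqI) (use line_down[OF _ lt(4), unfolded m] L_iff lf in simp)
    show "fibre (lns G) g (l 2) = {m \<in> lns G. (\<exists>x\<in>fibre (pts G) f (p 1). x \<in> points_on G m) \<and>
      (\<exists>y\<in>fibre (pts G) f (p 2). y \<in> points_on G m)}"
    proof (rule fibre_eqI)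
      fix m' assume m': "m' \<in> lns G"
      \<comment> \<open>A line meeting both fibres lies over \<open>l 1\<close> or
        \<open>l 2\<close>, and over \<open>l 2\<close> or \<open>l 3\<close>.\<close>
      show "g m' = l 2 \<longleftrightarrow> (\<exists>x\<in>fibre (pts G) f (p 1). x \<in> points_on G m') \<and>
        (\<exists>y\<in>fibre (pts G) f (p 2). y \<in> points_on G m')"
        unfolding lf using line_up[OF m' lt(2), unfolded m] line_down[OF m' lt(3), unfolded m]
          line_up[OF m' lt(3), unfolded m] line_down[OF m' lt(2), unfolded m] nl by metis
    qed
  qed
qed

text \<open>The points \<open>a\<close> to \<open>f\<close> are \<open>p 1\<close>,
  \<open>p 0\<close>, \<open>p 5\<close>, \<open>p 4\<close>, \<open>p 3\<close>,
  \<open>p 2\<close>: the naming runs against the indices, and \<open>l 0\<close> joins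
  \<open>b\<close> and \<open>c\<close>. The lines over \<open>l 3\<close> are described twice,
  going round the polygon either way.\<close>

lemma type_a6:
  assumes n6: "n = 6"
  shows "type_a6 G D f g"
proof -
  have lt: "0 < n" "1 < n" "2 < n" "3 < n" "4 < n" "5 < n" using n6 by auto
  have m: "Suc 0 mod n = 1" "Suc 1 mod n = 2" "Suc 2 mod n = 3" "Suc 3 mod n = 4" "Suc 4 mod n = 5"
    "Suc 5 mod n = 0" "n - 1 = 5"
    using n6 by auto
  note col = collinear_D[OF lt(1)] collinear_D[OF lt(2)] collinear_D[OF lt(3)] collinear_D[OF lt(4)]
    collinear_D[OF lt(5)] collinear_D[OF lt(6)]
  note col = col[unfolded m]
  note jn = join_D[OF lt(1)] join_D[OF lt(2)] join_D[OF lt(3)] join_D[OF lt(4)] join_D[OF lt(5)]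
    join_D[OF lt(6)]
  note jn = jn[unfolded m]
  have pd: "pts D = {p 1, p 0, p 5, p 4, p 3, p 2}"
    unfolding pts_D n6 by (auto simp: lessThan_Suc numeral_eq_Suc)
  have ne: "p 0 \<noteq> p 1" "p 0 \<noteq> p 2" "p 0 \<noteq> p 3" "p 0 \<noteq> p 4" "p 0 \<noteq> p 5" "p 1 \<noteq> p 2" "p 1 \<noteq> p 3"
    "p 1 \<noteq> p 4" "p 1 \<noteq> p 5" "p 2 \<noteq> p 3" "p 2 \<noteq> p 4" "p 2 \<noteq> p 5" "p 3 \<noteq> p 4" "p 3 \<noteq> p 5" "p 4 \<noteq> p 5"
    using p_eq lt by auto
  note ne = ne ne[symmetric]
  have col': "collinear D x y \<longleftrightarrow> collinear D y x" for x y by (auto simp: collinear_def)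
  have cf: "(\<exists>y \<in> fibre (pts G) f (p i). collinear G x y) \<longleftrightarrow> f x = p j \<or> f x = p i \<or> f x = p k"
    if "x \<in> pts G" "i < n" "k = Suc i mod n" "j < n" "i = Suc j mod n" for x i j k
    using collinear_fibre[OF that] inc_pts by (fastforce simp: fibre_def collinear_G)
  have lf: "(\<exists>y \<in> fibre (pts G) f q. y \<in> points_on G m) \<longleftrightarrow> (\<exists>y. (y, m) \<in> inc G \<and> f y = q)" for m q
    using inc_pts by (auto simp: fibre_def points_on_G)
  have onL: "x \<in> points_on G L \<longleftrightarrow> x \<in> pts G \<and> (f x = p 5 \<or> f x = p 0)" for x
    using on_L[of x] inc_pts m by (auto simp: points_on_G)
  have dist: "distinct [p 1, p 0, p 5, p 4, p 3, p 2]" using ne by auto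
  show ?thesis
    unfolding type_a6_def
  proof (intro exI[of _ "p 1"] exI[of _ "p 0"] exI[of _ "p 5"] exI[of _ "p 4"] exI[of _ "p 3"]
      exI[of _ "p 2"] conjI pd dist col col[THEN col'[THEN iffD1]],
      unfold Let_def jn, intro bexI[OF _ L(1)] conjI)
    show "fibre (pts G) f (p 5) \<union> fibre (pts G) f (p 0) = points_on G L"
      using onL by (auto simp: fibre_def)
    show "fibre (pts G) f (p 5) \<inter> fibre (pts G) f (p 0) = {}" using ne by (auto simp: fibre_def)
    show "fibre (pts G) f (p 5) \<noteq> {}" "fibre (pts G) f (p 0) \<noteq> {}" using fibre_ne m by auto
    show "fibre (pts G) f (p 4) = {x \<in> pts G. x \<notin> points_on G L \<and>
      (\<exists>y\<in>fibre (pts G) f (p 5). collinear G x y)}"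
    proof (rule fibre_eqI)
      fix x assume x: "x \<in> pts G"
      show "f x = p 4 \<longleftrightarrow> x \<notin> points_on G L \<and> (\<exists>y\<in>fibre (pts G) f (p 5). collinear G x y)"
        unfolding onL cf[OF x lt(6) m(6)[symmetric] lt(5) m(5)[symmetric]]
        using ne x by metis
    qed
    show "fibre (pts G) f (p 1) = {x \<in> pts G. x \<notin> points_on G L \<and>
      (\<exists>y\<in>fibre (pts G) f (p 0). collinear G x y)}"
    proof (rule fibre_eqI)
      fix x assume x: "x \<in> pts G"
      show "f x = p 1 \<longleftrightarrow> x \<notin> points_on G L \<and> (\<exists>y\<in>fibre (pts G) f (p 0). collinear G x y)"
        unfolding onL cf[OF x lt(1) m(1)[symmetric] lt(6) m(6)[symmetric]]
        using ne x by metis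
    qed
    show "fibre (pts G) f (p 3) = {x \<in> pts G. x \<notin> fibre (pts G) f (p 5) \<union> fibre (pts G) f (p 4) \<and>
      (\<exists>y\<in>fibre (pts G) f (p 4). collinear G x y)}"
    proof (rule fibre_eqI)
      fix x assume x: "x \<in> pts G"
      have "x \<in> fibre (pts G) f (p 5) \<union> fibre (pts G) f (p 4) \<longleftrightarrow> f x = p 5 \<or> f x = p 4"
        using x by (simp add: fibre_def)
      thus "f x = p 3 \<longleftrightarrow> x \<notin> fibre (pts G) f (p 5) \<union> fibre (pts G) f (p 4) \<and>
          (\<exists>y\<in>fibre (pts G) f (p 4). collinear G x y)"
        unfolding cf[OF x lt(5) m(5)[symmetric] lt(4) m(4)[symmetric]]
        using ne by metis
    qed
    show "fibre (pts G) f (p 2) = {x \<in> pts G. x \<notin> fibre (pts G) f (p 1) \<union> fibre (pts G) f (p 0) \<and>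
      (\<exists>y\<in>fibre (pts G) f (p 1). collinear G x y)}"
    proof (rule fibre_eqI)
      fix x assume x: "x \<in> pts G"
      have "x \<in> fibre (pts G) f (p 1) \<union> fibre (pts G) f (p 0) \<longleftrightarrow> f x = p 1 \<or> f x = p 0"
        using x by (simp add: fibre_def)
      thus "f x = p 2 \<longleftrightarrow> x \<notin> fibre (pts G) f (p 1) \<union> fibre (pts G) f (p 0) \<and>
          (\<exists>y\<in>fibre (pts G) f (p 1). collinear G x y)"
        unfolding cf[OF x lt(2) m(2)[symmetric] lt(1) m(1)[symmetric]]
        using ne by metis
    qed
    show "fibre (lns G) g (l 0) = {L}" using L by (auto simp: fibre_def)
    show "fibre (lns G) g (l 5) = {m \<in> lns G. m \<noteq> L \<and> (\<exists>y\<in>fibre (pts G) f (p 5). y \<in> points_on G m)}"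
      by (rule fibre_eqI) (use line_down[OF _ lt(6), unfolded m] L_iff lf in simp)
    show "fibre (lns G) g (l 1) = {m \<in> lns G. m \<noteq> L \<and> (\<exists>y\<in>fibre (pts G) f (p 0). y \<in> points_on G m)}"
      by (rule fibre_eqI) (use line_up[OF _ lt(1), unfolded m] L_iff lf in simp)
    show "fibre (lns G) g (l 4) = {m \<in> lns G. m \<notin> fibre (lns G) g (l 5) \<and>
      (\<exists>y\<in>fibre (pts G) f (p 4). y \<in> points_on G m)}"
      by (rule fibre_eqI) (use line_down[OF _ lt(5), unfolded m] lf in \<open>simp add: fibre_def[of "lns G"]\<close>)
    show "fibre (lns G) g (l 2) = {m \<in> lns G. m \<notin> fibre (lns G) g (l 1) \<and>
      (\<exists>y\<in>fibre (pts G) f (p 1). y \<in> points_on G m)}"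
      by (rule fibre_eqI) (use line_up[OF _ lt(2), unfolded m] lf in \<open>simp add: fibre_def[of "lns G"]\<close>)
    show "fibre (lns G) g (l 3) = {m \<in> lns G. m \<notin> fibre (lns G) g (l 2) \<and>
      (\<exists>y\<in>fibre (pts G) f (p 2). y \<in> points_on G m)}"
      by (rule fibre_eqI) (use line_up[OF _ lt(3), unfolded m] lf in \<open>simp add: fibre_def[of "lns G"]\<close>)
    show "fibre (lns G) g (l 3) = {m \<in> lns G. m \<notin> fibre (lns G) g (l 4) \<and>
      (\<exists>y\<in>fibre (pts G) f (p 3). y \<in> points_on G m)}"
      by (rule fibre_eqI) (use line_down[OF _ lt(4), unfolded m] lf in \<open>simp add: fibre_def[of "lns G"]\<close>)
  qed
qed

lemma type_a: "n \<in> {4, 6} \<Longrightarrow> type_a n G D f g"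
  using type_a4 type_a6 by (auto simp: type_a_def)

end

section \<open>Ordinary polygons as single cycles\<close>

lemma (in weak_gon) elements_cycle:
  assumes deg2: "\<And>x a b c. adjacent G x a \<Longrightarrow> adjacent G x b \<Longrightarrow> adjacent G x c \<Longrightarrow> a = b \<or> a = c \<or> b = c"
    and u: "u \<in> elements G"
  obtains c where "c 0 = u" "elements G = c ` {..<2 * n}" "inj_on c {..<2 * n}"
    "\<And>i j. i < 2 * n \<Longrightarrow> j < 2 * n \<Longrightarrow>
      adjacent G (c i) (c j) \<longleftrightarrow> j = Suc i mod (2 * n) \<or> i = Suc j mod (2 * n)"
proof -
  obtain b i0 where b: "\<And>i. adjacent G (b i) (b (Suc i))" "\<And>i. b (i + 2 * n) = b i" "u = b i0"
    "\<And>i. b (Suc i) \<noteq> b (Suc i + 2 * (n - 1))" using common_gon[OF u u] by metis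
  define c where "c i = b (i0 + i)" for i
  have c: "adjacent G (c i) (c (Suc i))" "c (i + 2 * n) = c i" "c 0 = u"
    "c (Suc i) \<noteq> c (Suc i + 2 * (n - 1))" for i
    using b(1)[of "i0 + i"] b(2)[of "i0 + i"] b(3) b(4)[of "i0 + i"] by (simp_all add: c_def add.assoc)
  \<comment> \<open>The index \<open>i + (2 * n - 1)\<close> stands for \<open>i - 1\<close>,
    without subtraction at \<open>0\<close>.\<close>
  have n2: "Suc i + 2 * (n - 1) = i + (2 * n - 1)" for i using n3 by simp
  have c_ne: "c (Suc i) \<noteq> c (i + (2 * n - 1))" for i using c(4)[of i] unfolding n2 .
  have c_mod: "c i = c (i mod (2 * n))" for i
  proof -
    have "c (r + q * (2 * n)) = c r" for q r
    proof (induction q)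
      case (Suc q)
      have "r + Suc q * (2 * n) = r + q * (2 * n) + 2 * n" by simp
      thus ?case using Suc c(2) by metis
    qed simp
    from this[of "i mod (2 * n)" "i div (2 * n)"] show ?thesis by (simp add: mult.commute)
  qed
  have prev: "adjacent G (c i) (c (i + (2 * n - 1)))" for i
  proof -
    have "Suc (i + (2 * n - 1)) = i + 2 * n" using n3 by simp
    thus ?thesis using c(1)[of "i + (2 * n - 1)"] c(2)[of i] adjacent_sym by metis
  qed
  have nbr: "adjacent G (c i) v \<longleftrightarrow> v = c (Suc i) \<or> v = c (i + (2 * n - 1))" for i v
    using deg2[of "c i" "c (Suc i)" "c (i + (2 * n - 1))" v] c(1)[of i] c_ne[of i] prev[of i] by metis
  \<comment> \<open>The circuit contains all neighbours of its vertices, so by connectedness it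
    exhausts the graph.\<close>
  have closed: "v \<in> range c" if "(adjacent G ^^ k) u v" for k v
    using that
  proof (induction k arbitrary: v)
    case 0
    thus ?case using c(3) by auto
  next
    case (Suc k)
    then obtain w where "(adjacent G ^^ k) u w" "adjacent G w v" by (auto elim: relpowp_Suc_E)
    thus ?case using Suc.IH[of w] nbr by auto
  qed
  have "elements G \<subseteq> c ` {..<2 * n}"
  proof
    fix v assume "v \<in> elements G"
    then obtain i where "v = c i" using closed[OF gdist_walk[OF u]] by blast
    thus "v \<in> c ` {..<2 * n}" using c_mod[of i] n3 by auto
  qed
  moreover have "c i \<in> elements G" for i using c(1) adjacent_in by blast
  ultimately have el: "elements G = c ` {..<2 * n}" by blast
  \<comment> \<open>By \<open>retraction_inj\<close> there are no fewer than \<open>2 * n\<close>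
    vertices, so the circuit has no repetitions.\<close>
  have "inj_on c {..<2 * n}"
  proof (rule eq_card_imp_inj_on)
    have "adjacent G (c 0) (c 1)" using c(1)[of 0] by simp
    moreover have "card (elements G) \<le> 2 * n" using card_image_le[of "{..<2 * n}" c] el by simp
    ultimately show "card (c ` {..<2 * n}) = card {..<2 * n}" using retraction_inj(1) el by simp
  qed simp
  moreover have "adjacent G (c i) (c j) \<longleftrightarrow> j = Suc i mod (2 * n) \<or> i = Suc j mod (2 * n)"
    if ij: "i < 2 * n" "j < 2 * n" for i j
  proof -
    have inj: "c a = c b \<longleftrightarrow> a = b" if "a < 2 * n" "b < 2 * n" for a b
      using \<open>inj_on c {..<2 * n}\<close> that by (auto simp: inj_on_def)
    have lt: "Suc i mod (2 * n) < 2 * n" "(i + (2 * n - 1)) mod (2 * n) < 2 * n" using n3 by auto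
    have "c j = c (Suc i) \<longleftrightarrow> j = Suc i mod (2 * n)"
      using inj[OF ij(2) lt(1)] c_mod[of "Suc i"] by simp
    moreover have "c j = c (i + (2 * n - 1)) \<longleftrightarrow> j = (i + (2 * n - 1)) mod (2 * n)"
      using inj[OF ij(2) lt(2)] c_mod[of "i + (2 * n - 1)"] by simp
    moreover have "j = (i + (2 * n - 1)) mod (2 * n) \<longleftrightarrow> i = Suc j mod (2 * n)"
    proof (cases i)
      case 0
      thus ?thesis using ij n3 by (auto simp: mod_Suc)
    next
      case (Suc k)
      hence "i + (2 * n - 1) = k + 2 * n" using n3 by simp
      hence "(i + (2 * n - 1)) mod (2 * n) = k" using ij Suc by simp
      thus ?thesis using ij Suc by (auto simp: mod_Suc)
    qed
    ultimately show ?thesis using nbr[of i "c j"] by blast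
  qed
  ultimately show thesis using that[OF c(3) el] by blast
qed

text \<open>The cycle starts at a line, so lines have even and points odd indices, and
  \<open>p i\<close> stands between \<open>l i\<close> and the next line.\<close>

lemma lifted_gonI:
  assumes n: "3 \<le> n" and G: "point_line_geometry G" and D: "point_line_geometry D"
    and epi: "epimorphism G D f g"
    and c0: "\<not> isl (c 0)" and el: "elements D = c ` {..<2 * n}" and inj: "inj_on c {..<2 * n}"
    and adj: "\<And>i j. i < 2 * n \<Longrightarrow> j < 2 * n \<Longrightarrow>
      adjacent D (c i) (c j) \<longleftrightarrow> j = Suc i mod (2 * n) \<or> i = Suc j mod (2 * n)"
    and L: "L \<in> lns G" "\<And>m. m \<in> lns G \<Longrightarrow> Inr (g m) = c 0 \<longleftrightarrow> m = L"
    and lift: "\<And>x v. x \<in> elements G \<Longrightarrow> adjacent D (map_sum f g x) v \<Longrightarrow>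
      \<exists>y. adjacent G x y \<and> map_sum f g y = v"
  obtains p l where "lifted_gon n G D f g p l L"
proof -
  have isl: "isl (c i) \<longleftrightarrow> odd i" if "i < 2 * n" for i
    using that
  proof (induction i)
    case (Suc i)
    thus ?case using adjacent_isl[of D "c i" "c (Suc i)"] adj[of i "Suc i"] by auto
  qed (use c0 in simp)
  define l where "l i = projr (c (2 * i))" for i
  define p where "p i = projl (c (2 * i + 1))" for i
  have l: "c (2 * i) = Inr (l i)" if "i < n" for i using isl[of "2 * i"] that by (simp add: l_def)
  have p: "c (2 * i + 1) = Inl (p i)" if "i < n" for i using isl[of "2 * i + 1"] that by (simp add: p_def)
  have range: "{..<2 * n} = (\<lambda>i. 2 * i) ` {..<n} \<union> (\<lambda>i. 2 * i + 1) ` {..<n}"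
  proof
    show "{..<2 * n} \<subseteq> (\<lambda>i. 2 * i) ` {..<n} \<union> (\<lambda>i. 2 * i + 1) ` {..<n}"
    proof
      fix i assume "i \<in> {..<2 * n}"
      thus "i \<in> (\<lambda>i. 2 * i) ` {..<n} \<union> (\<lambda>i. 2 * i + 1) ` {..<n}"
        by (cases "even i") (auto elim!: evenE oddE)
    qed
  qed auto
  have "elements D = Inr ` l ` {..<n} \<union> Inl ` p ` {..<n}"
    unfolding el range image_Un image_image using l p by (intro arg_cong2[of _ _ _ _ "(\<union>)"] image_cong) auto
  hence pl: "pts D = p ` {..<n}" "lns D = l ` {..<n}" unfolding elements_def by auto
  have inj_l: "inj_on l {..<n}"
  proof (rule inj_onI)
    fix i j assume "i \<in> {..<n}" "j \<in> {..<n}" "l i = l j"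
    thus "i = j" using inj_onD[OF inj, of "2 * i" "2 * j"] l by auto
  qed
  have inj_p: "inj_on p {..<n}"
  proof (rule inj_onI)
    fix i j assume "i \<in> {..<n}" "j \<in> {..<n}" "p i = p j"
    thus "i = j" using inj_onD[OF inj, of "2 * i + 1" "2 * j + 1"] p by auto
  qed
  have "lifted_gon n G D f g p l L"
  proof
    show "3 \<le> n" "pts D = p ` {..<n}" "inj_on p {..<n}" "lns D = l ` {..<n}" "inj_on l {..<n}" "L \<in> lns G"
      using n pl inj_l inj_p L by auto
    show "x \<in> pts G \<and> m \<in> lns G" if "(x, m) \<in> inc G" for x m
      using that G by (auto simp: point_line_geometry_def)
    show "(p i, l j) \<in> inc D \<longleftrightarrow> j = i \<or> j = Suc i mod n" if "i < n" "j < n" for i j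
    proof -
      have "(p i, l j) \<in> inc D \<longleftrightarrow> adjacent D (c (2 * i + 1)) (c (2 * j))" using p l that by simp
      also have "\<dots> \<longleftrightarrow> 2 * j = Suc (2 * i + 1) mod (2 * n) \<or> 2 * i + 1 = Suc (2 * j) mod (2 * n)"
        using adj[of "2 * i + 1" "2 * j"] that by simp
      also have "Suc (2 * j) mod (2 * n) = 2 * j + 1" using that by simp
      also have "Suc (2 * i + 1) mod (2 * n) = 2 * (Suc i mod n)" using mult_mod_right[of 2 "Suc i" n] by simp
      finally show ?thesis by auto
    qed
    show "f x \<in> pts D" if "x \<in> pts G" for x using epi that by (auto simp: epimorphism_def)
    show "g m \<in> lns D" if "m \<in> lns G" for m using epi that by (auto simp: epimorphism_def)
    show "(f x, g m) \<in> inc D" if "(x, m) \<in> inc G" for x m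
      using epi that by (auto simp: epimorphism_def morphism_def)
    show "\<exists>m. (x, m) \<in> inc G \<and> g m = k" if "x \<in> pts G" "(f x, k) \<in> inc D" for x k
      using lift[of "Inl x" "Inr k"] that by (auto simp: adjacent_def)
    show "\<exists>x. (x, m) \<in> inc G \<and> f x = q" if "m \<in> lns G" "(q, g m) \<in> inc D" for m q
      using lift[of "Inr m" "Inl q"] that by (auto simp: adjacent_def)
    show "g m = l 0 \<longleftrightarrow> m = L" if "m \<in> lns G" for m using L(2)[OF that] l[of 0] n by simp
  qed
  thus thesis by (rule that)
qed

section \<open>Exchanging points and lines\<close>

definition swap_sum :: "'a + 'b \<Rightarrow> 'b + 'a" where
  "swap_sum = case_sum Inr Inl"

lemma swap_sum_simps [simp]: "swap_sum (Inl x) = Inr x" "swap_sum (Inr y) = Inl y"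
  by (simp_all add: swap_sum_def)

lemma swap_swap [simp]: "swap_sum (swap_sum x) = x"
  by (cases x) auto

lemma isl_swap [simp]: "isl (swap_sum x) \<longleftrightarrow> \<not> isl x"
  by (cases x) auto

lemma adjacent_dual [simp]: "adjacent (dual G) x y \<longleftrightarrow> adjacent G (swap_sum x) (swap_sum y)"
  by (cases x; cases y) (auto simp: dual_def)

lemma elements_dual: "elements (dual G) = swap_sum ` elements G"
  by (auto simp: elements_def dual_def Plus_def image_Un image_image)

lemma map_sum_swap: "map_sum g f x = swap_sum (map_sum f g (swap_sum x))"
  by (cases x) auto

context gon_epimorphism
begin

text \<open>\<Delta> has \<open>2 * n\<close> vertices, so the retraction is injective and lifting
  up to labels becomes lifting of vertices. The vertex \<open>e\<close> is a line or a point; in the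
  second case the dual geometries are used.\<close>

lemma ordinary_type:
  assumes deg2: "\<And>x a b c. adjacent \<Delta> x a \<Longrightarrow> adjacent \<Delta> x b \<Longrightarrow> adjacent \<Delta> x c \<Longrightarrow> a = b \<or> a = c \<or> b = c"
  shows "(\<exists>p l L. lifted_gon n \<Gamma> \<Delta> f g p l L) \<or> (\<exists>p l L. lifted_gon n (dual \<Gamma>) (dual \<Delta>) g f p l L)"
proof -
  obtain a b where ab: "adjacent \<Delta> a b"
  proof -
    obtain x where "x \<in> elements \<Delta>" using cod.weak by (auto simp: weak_generalized_gon_def)
    thus thesis using cod.deg_ge_2 that by blast
  qed
  let ?\<rho> = "cod.retraction a b"
  obtain u e where u: "u \<in> elements \<Delta>" "e \<in> elements \<Gamma>" "\<And>x. x \<in> elements \<Gamma> \<Longrightarrow> \<gamma> x = u \<longleftrightarrow> x = e"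
    and "\<And>x. x \<in> elements \<Gamma> \<Longrightarrow> gdist \<Gamma> e x = gdist \<Delta> u (\<gamma> x)"
    and "\<And>v. v \<in> elements \<Delta> \<Longrightarrow> 2 * int n dvd ?\<rho> v - ?\<rho> u \<Longrightarrow> v = u"
    and lift: "\<And>x v. x \<in> elements \<Gamma> \<Longrightarrow> adjacent \<Delta> (\<gamma> x) v \<Longrightarrow>
      \<exists>y. adjacent \<Gamma> x y \<and> 2 * int n dvd ?\<rho> (\<gamma> y) - ?\<rho> v"
    by (rule singleton_fibre[OF ab]) (rule that)
  obtain c where c: "c 0 = u" "elements \<Delta> = c ` {..<2 * n}" "inj_on c {..<2 * n}"
    "\<And>i j. i < 2 * n \<Longrightarrow> j < 2 * n \<Longrightarrow>
      adjacent \<Delta> (c i) (c j) \<longleftrightarrow> j = Suc i mod (2 * n) \<or> i = Suc j mod (2 * n)"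
    by (rule cod.elements_cycle[OF _ u(1)], rule deg2, assumption+, rule that)
  have "finite (elements \<Delta>)" "card (elements \<Delta>) \<le> 2 * n" using card_image[OF c(3)] c(2) by auto
  note inj = cod.retraction_inj(2)[OF ab this]
  have lift': "\<exists>y. adjacent \<Gamma> x y \<and> \<gamma> y = v" if x: "x \<in> elements \<Gamma>" "adjacent \<Delta> (\<gamma> x) v" for x v
  proof -
    obtain y where y: "adjacent \<Gamma> x y" "2 * int n dvd ?\<rho> (\<gamma> y) - ?\<rho> v" using lift[OF x] by blast
    have "\<gamma> y \<in> elements \<Delta>" "v \<in> elements \<Delta>" using y x \<gamma>_in dom.adj_in2 cod.adj_in2 by blast+
    thus ?thesis using y inj by blast
  qed
  have e: "\<gamma> e = u" using u by blast
  show ?thesis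
  proof (cases u)
    case (Inr k)
    then obtain L where L: "e = Inr L" using e by (cases e) auto
    have "Inr (g m) = c 0 \<longleftrightarrow> m = L" if "m \<in> lns \<Gamma>" for m
      using u(3)[of "Inr m"] that L c(1) by simp
    then obtain p l where "lifted_gon n \<Gamma> \<Delta> f g p l L"
      using lifted_gonI[OF dom.n3 dom.geometry cod.geometry epi _ c(2-4), of L] c(1) Inr L u(2) lift' by auto
    thus ?thesis by blast
  next
    case (Inl k)
    then obtain L where L: "e = Inl L" using e by (cases e) auto
    have geo: "point_line_geometry (dual \<Gamma>)" "point_line_geometry (dual \<Delta>)"
      using dom.geometry cod.geometry by (auto simp: point_line_geometry_def dual_def)
    have epi': "epimorphism (dual \<Gamma>) (dual \<Delta>) g f"
      using epi by (auto simp: epimorphism_def morphism_def dual_def)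
    let ?c = "\<lambda>i. swap_sum (c i)"
    have "elements (dual \<Delta>) = ?c ` {..<2 * n}" unfolding elements_dual c(2) image_image ..
    moreover have "inj_on ?c {..<2 * n}"
      using c(3) unfolding inj_on_def by (metis swap_swap)
    moreover have "adjacent (dual \<Delta>) (?c i) (?c j) \<longleftrightarrow> j = Suc i mod (2 * n) \<or> i = Suc j mod (2 * n)"
      if "i < 2 * n" "j < 2 * n" for i j using c(4)[OF that] by simp
    moreover have "L \<in> lns (dual \<Gamma>)" using L u(2) by (simp add: dual_def)
    moreover have "Inr (f m) = ?c 0 \<longleftrightarrow> m = L" if "m \<in> lns (dual \<Gamma>)" for m
      using u(3)[of "Inl m"] that L c(1) Inl by (auto simp: dual_def)
    moreover have "\<exists>y. adjacent (dual \<Gamma>) x y \<and> map_sum g f y = v"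
      if "x \<in> elements (dual \<Gamma>)" "adjacent (dual \<Delta>) (map_sum g f x) v" for x v
    proof -
      have "swap_sum x \<in> elements \<Gamma>" using that(1) by (auto simp: elements_dual)
      moreover have "adjacent \<Delta> (\<gamma> (swap_sum x)) (swap_sum v)"
        using that(2) by (simp add: map_sum_swap[of g f])
      ultimately obtain y where y: "adjacent \<Gamma> (swap_sum x) y" "\<gamma> y = swap_sum v" using lift' by blast
      thus ?thesis by (intro exI[of _ "swap_sum y"]) (simp add: map_sum_swap[of g f])
    qed
    moreover have "\<not> isl (?c 0)" using c(1) Inl by simp
    ultimately obtain p l where "lifted_gon n (dual \<Gamma>) (dual \<Delta>) g f p l L"
      using lifted_gonI[OF dom.n3 geo epi', of ?c L] by blast
    thus ?thesis by blast
  qed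
qed

end

theorem theorem6p3:
  fixes \<Gamma> :: "('p, 'l) geometry" and \<Delta> :: "('q, 'm) geometry"
    and f :: "'p \<Rightarrow> 'q" and g :: "'l \<Rightarrow> 'm"
    and n :: nat and s :: enat
  assumes "n \<in> {4, 6}"
    and "thick_generalized_gon n \<Gamma>"
    and "locally_finitely_chained n \<Gamma>"
    and "thin_gon n \<Delta>"
    and "has_order \<Delta> s 1"
    and "epimorphism \<Gamma> \<Delta> f g"
  shows "s = 1 \<and> (type_a n \<Gamma> \<Delta> f g \<or> type_b n \<Gamma> \<Delta> f g)"
proof -
  interpret gon_epimorphism n \<Gamma> \<Delta> f g
    using assms by unfold_locales (auto simp: thick_generalized_gon_def thin_gon_def)
  have order: "ecard (points_on \<Delta> m) = s + 1" if "m \<in> lns \<Delta>" for m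
    using assms(5) that by (simp add: has_order_def)
  have in_on: "q \<in> points_on \<Delta> m" "m \<in> lines_through \<Delta> q" if "(q, m) \<in> inc \<Delta>" for q m
    using that cod.geometry by (auto simp: points_on_def lines_through_def point_line_geometry_def)
  have two: "a = b \<or> a = c \<or> b = c" if "ecard A \<le> 2" "a \<in> A" "b \<in> A" "c \<in> A" for A :: "'z set" and a b c
  proof (rule ccontr)
    assume "\<not> ?thesis"
    hence "3 \<le> ecard A" unfolding ecard_ge_3 using that by (intro exI[of _ a] exI[of _ b] exI[of _ c]) auto
    hence "(3::enat) \<le> 2" using that(1) by (rule order_trans)
    thus False by simp
  qed
  have deg2: "k1 = k2 \<or> k1 = k3 \<or> k2 = k3"
    if "p \<in> pts \<Delta>" "(p, k1) \<in> inc \<Delta>" "(p, k2) \<in> inc \<Delta>" "(p, k3) \<in> inc \<Delta>" for p k1 k2 k3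
  proof -
    have "ecard (lines_through \<Delta> p) = 1 + 1" using assms(5) that(1) by (simp add: has_order_def)
    hence "ecard (lines_through \<Delta> p) \<le> 2" by (simp add: one_add_one)
    thus ?thesis using two[OF _ in_on(2)[OF that(2)] in_on(2)[OF that(3)] in_on(2)[OF that(4)]] by simp
  qed
  obtain x where x: "x \<in> elements \<Delta>" using cod.weak by (auto simp: weak_generalized_gon_def)
  then obtain p0 m0 where p0: "p0 \<in> pts \<Delta>" and m0: "m0 \<in> lns \<Delta>"
    using cod.deg_ge_2[OF x] cod.adj_in cod.adj_in2 elements_simps by (fastforce simp: adjacent_def)
  have n: "even n" "4 \<le> n" using assms(1) by auto
  \<comment> \<open>In this form infinite \<open>s\<close> is excluded together with finite
    \<open>s\<close> above 1.\<close>
  have "\<not> 3 \<le> s + 1"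
  proof
    assume s: "3 \<le> s + 1"
    have thick_lines: "\<exists>q. (q, m) \<in> inc \<Delta> \<and> q \<noteq> x \<and> q \<noteq> y" if "m \<in> lns \<Delta>" for m x y
    proof -
      have "3 \<le> ecard (points_on \<Delta> m)" using s order[OF that] by simp
      then obtain a b c where "a \<in> points_on \<Delta> m" "b \<in> points_on \<Delta> m" "c \<in> points_on \<Delta> m"
        "distinct [a, b, c]" unfolding ecard_ge_3 by blast
      thus ?thesis unfolding points_on_def by (metis (mono_tags, lifting) distinct_length_2_or_more mem_Collect_eq)
    qed
    show False by (rule not_order_ge_2[OF n]) (fact deg2 thick_lines p0)+
  qed
  moreover have "s \<noteq> 0"
  proof
    assume "s = 0"
    hence "ecard (points_on \<Delta> m0) = 1" using order[OF m0] by simp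
    hence "card (points_on \<Delta> m0) = 1" by (auto simp: ecard_def one_enat_def split: if_splits)
    then obtain q where q: "points_on \<Delta> m0 = {q}" by (rule card_1_singletonE)
    obtain y z where "adjacent \<Delta> (Inr m0) y" "adjacent \<Delta> (Inr m0) z" "y \<noteq> z"
      using cod.deg_ge_2[of "Inr m0"] m0 by auto
    thus False using in_on(1)[of _ m0] q by (auto simp: adjacent_def)
  qed
  ultimately have s: "s = 1"
    by (cases s) (auto simp: one_enat_def numeral_eq_enat zero_enat_def)
  have nbrs: "a = b \<or> a = c \<or> b = c" if *: "adjacent \<Delta> x a" "adjacent \<Delta> x b" "adjacent \<Delta> x c" for x a b c
  proof (cases x)
    case (Inl p)
    thus ?thesis using * deg2[of p] cod.adj_in[OF *(1)] by (auto simp: adjacent_def)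
  next
    case (Inr m)
    hence "ecard (points_on \<Delta> m) \<le> 2"
      using order[of m] cod.adj_in[OF *(1)] s by (simp add: one_add_one)
    thus ?thesis using two[of "points_on \<Delta> m"] in_on(1)[of _ m] * Inr by (auto simp: adjacent_def)
  qed
  have "(\<exists>p l L. lifted_gon n \<Gamma> \<Delta> f g p l L) \<or> (\<exists>p l L. lifted_gon n (dual \<Gamma>) (dual \<Delta>) g f p l L)"
    by (rule ordinary_type) (fact nbrs)
  hence "type_a n \<Gamma> \<Delta> f g \<or> type_a n (dual \<Gamma>) (dual \<Delta>) g f"
  proof (elim disjE exE)
    fix p l L assume *: "lifted_gon n \<Gamma> \<Delta> f g p l L"
    from lifted_gon.type_a[OF * assms(1)] show ?thesis by blast
  next
    fix p l L assume *: "lifted_gon n (dual \<Gamma>) (dual \<Delta>) g f p l L"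
    from lifted_gon.type_a[OF * assms(1)] show ?thesis by blast
  qed
  thus ?thesis using s by (simp add: type_b_def)
qed

end
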